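(* Let $t_0$ be a fixed interior point of $J$ and let $x_n=x_{b,n}+v_n$, $p$, $d_n$, $\tilde v_n(\cdot;t_0)$, $g_n$, $y_n$ be as in the context. Suppose that: (A1) there is a stochastic process $\tilde v(\cdot;t_0)\neq 0$ such that $\tilde v_n(\cdot;t_0)\xrightarrow{\mathcal L}\tilde v(\cdot;t_0)$ on $D(-\infty,\infty)$ as $n\to\infty$; (A2) the functions $x_{b,n}$, $n\ge1$, are convex, and there is a constant $A>0$ such that for each $c>0$, $\sup_{|s|\le c}|g_n(s)-A|s|^p|\to0$ as $n\to\infty$. Let $y(s)=A|s|^p+\tilde v(s;t_0)$. Assume that $y$ takes its values in a separable set of completely regular points with probability one, and that for each $a\in\mathbb R$ and $c,\varepsilon>0$, $$P\left(y(s)-y(0)-as\ge\varepsilon|s|\ \text{for all } s\in[-c,c]\right)=0.$$ Then for each $c>0$, $$T_c(y_n)'(0)\xrightarrow{\mathcal L}T_c(y)'(0)\quad\text{as }n\to\infty.$$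
   Context: $J\subset\mathbb R$ is a finite or infinite interval; $D(J)$ is the space of functions $J\to\mathbb R$ that are right continuous with left-hand limits. For an interval $O$ and a function $x$ on $O$, $T_O(x)=\sup\{z: z:O\to\mathbb R \text{ convex}, z\le x\}$ is the greatest convex minorant of $x$ on $O$, and $T_O(x)'$ its right-hand derivative; $T_c=T_{[-c,c]}$. $\{x_n\}_{n\ge1}$ is a sequence of stochastic processes in $D(J)$, a.s. bounded from below on $J$, with $x_n(t)=x_{b,n}(t)+v_n(t)$, $t\in J$, where $x_{b,n}$ is deterministic and $v_n\in D(J)$ is a stochastic process. $1<p<\infty$ is a fixed constant and $d_n\downarrow0$ a fixed sequence. Put $J_{n,t_0}=d_n^{-1}(J-t_0)$ and, for $s\in J_{n,t_0}$, $$\tilde v_n(s;t_0)=d_n^{-p}(v_n(t_0+sd_n)-v_n(t_0)),$$ $$g_n(s)=d_n^{-p}\left(x_{b,n}(t_0+sd_n)-x_{b,n}(t_0)-x_{b,n}'(t_0)sd_n\right),\qquad y_n(s)=g_n(s)+\tilde v_n(s;t_0).$$ When regarded as an element of $D(-\infty,\infty)$, $\tilde v_n(\cdot;t_0)$ is extended from $J_{n,t_0}$ to $\mathbb R$ by constants beyond the endpoints of $J_{n,t_0}$. $D(-\infty,\infty)=D(\mathbb R)$ carries the metric $\rho(x,y)=\sum_{k\ge1}2^{-k}\rho_k(x,y)/(1+\rho_k(x,y))$, $\rho_k(x,y)=\sup_{s\in[-k,k]}|x(s)-y(s)|$, and the $\sigma$-algebra generated by the open balls; $\xrightarrow{\mathcal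 L}$ denotes weak convergence. Completely regular point (Pollard, Convergence of Stochastic Processes, 1984): a point $x$ of a metric space with a $\sigma$-field $\mathcal A$ is completely regular if to each neighbourhood $V$ of $x$ there is a uniformly continuous, $\mathcal A$-measurable function $g$ with $g(x)=1$ and $g\le\mathbf 1_V$. *)

theory Defs
  imports "HOL-Probability.Probability"
begin

section \<open>The space of right-continuous functions with left limits\<close>

text \<open>
  A function on an interval \<open>J\<close> is represented by a total function whose values off \<open>J\<close> are
  irrelevant.  At a left endpoint belonging to \<open>J\<close> the left-hand filter is \<open>bot\<close>, so the condition
  on left limits is void there.
\<close>

definition cadlag_on :: "real set \<Rightarrow> (real \<Rightarrow> real) set" where
  "cadlag_on J = {x. \<forall>t\<in>J. (x \<longlongrightarrow> x t) (at t within (J \<inter> {t<..})) \<and>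
                            (\<exists>l. (x \<longlongrightarrow> l) (at t within (J \<inter> {..<t})))}"

definition rho_k :: "nat \<Rightarrow> (real \<Rightarrow> real) \<Rightarrow> (real \<Rightarrow> real) \<Rightarrow> real" where
  "rho_k k x y = (SUP s\<in>{- real k..real k}. \<bar>x s - y s\<bar>)"

text \<open>The summation index is shifted by one: the sum runs over \<open>k \<ge> 1\<close>.\<close>

definition rho :: "(real \<Rightarrow> real) \<Rightarrow> (real \<Rightarrow> real) \<Rightarrow> real" where
  "rho x y = (\<Sum>k. (1 / 2) ^ Suc k * (rho_k (Suc k) x y / (1 + rho_k (Suc k) x y)))"

text \<open>
  The guard is there only because \<^locale>\<open>Metric_space\<close> requires nonnegativity of the distance for
  arbitrary arguments, including functions with an infinite supremum.
\<close>

definition D_metric :: "(real \<Rightarrow> real) metric" where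
  "D_metric = metric (cadlag_on UNIV,
     \<lambda>x y. if x \<in> cadlag_on UNIV \<and> y \<in> cadlag_on UNIV then rho x y else 0)"

definition ball_algebra :: "'a metric \<Rightarrow> 'a measure" where
  "ball_algebra m = sigma (mspace m) {mball_of m x r | x r. x \<in> mspace m}"

lemma cadlag_locally_bounded:
  fixes x :: "real \<Rightarrow> real"
  assumes x: "x \<in> cadlag_on UNIV"
  shows "bounded (x ` {a..b})"
proof -
  have "\<exists>U B. open U \<and> t \<in> U \<and> (\<forall>s\<in>U. \<bar>x s\<bar> \<le> B)" for t
  proof -
    from x obtain l where r: "(x \<longlongrightarrow> x t) (at t within {t<..})"
      and l: "(x \<longlongrightarrow> l) (at t within {..<t})"
      unfolding cadlag_on_def by auto
    have "eventually (\<lambda>s. \<bar>x s\<bar> < \<bar>x t\<bar> + 1) (at t within {t<..})"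
      by (rule order_tendstoD(2)[OF tendsto_rabs[OF r]]) simp
    moreover have "eventually (\<lambda>s. \<bar>x s\<bar> < \<bar>l\<bar> + 1) (at t within {..<t})"
      by (rule order_tendstoD(2)[OF tendsto_rabs[OF l]]) simp
    ultimately have "eventually (\<lambda>s. \<bar>x s\<bar> \<le> \<bar>x t\<bar> + \<bar>l\<bar> + 1) (at t)"
      unfolding eventually_at_split by (auto elim!: eventually_mono)
    then obtain U where "open U" "t \<in> U" "\<forall>s\<in>U. s \<noteq> t \<longrightarrow> \<bar>x s\<bar> \<le> \<bar>x t\<bar> + \<bar>l\<bar> + 1"
      unfolding eventually_at_topological by auto
    then show ?thesis
      by (intro exI[of _ U] exI[of _ "\<bar>x t\<bar> + \<bar>l\<bar> + 1"]) force
  qed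
  then obtain U B where U: "\<And>t. open (U t)" "\<And>t. t \<in> U t" "\<And>t s. s \<in> U t \<Longrightarrow> \<bar>x s\<bar> \<le> B t"
    by metis
  obtain T where T: "T \<subseteq> {a..b}" "finite T" "{a..b} \<subseteq> (\<Union>t\<in>T. U t)"
    by (rule compactE_image[of "{a..b}" "{a..b}" U]) (use U in auto)
  have "\<bar>x s\<bar> \<le> (\<Sum>t\<in>T. \<bar>B t\<bar>)" if s: "s \<in> {a..b}" for s
  proof -
    obtain t where "t \<in> T" "s \<in> U t" using T s by blast
    then have "\<bar>x s\<bar> \<le> \<bar>B t\<bar>" using U(3) by fastforce
    also have "\<dots> \<le> (\<Sum>t\<in>T. \<bar>B t\<bar>)" by (rule member_le_sum) (use T \<open>t \<in> T\<close> in auto)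
    finally show ?thesis .
  qed
  then show ?thesis
    unfolding bounded_iff by (intro exI[of _ "\<Sum>t\<in>T. \<bar>B t\<bar>"]) auto
qed

lemma bdd_above_rho_k:
  assumes "x \<in> cadlag_on UNIV" "y \<in> cadlag_on UNIV"
  shows "bdd_above ((\<lambda>s. \<bar>x s - y s\<bar>) ` {- real k..real k})"
proof -
  obtain B C where "\<forall>s\<in>{- real k..real k}. \<bar>x s\<bar> \<le> B" "\<forall>s\<in>{- real k..real k}. \<bar>y s\<bar> \<le> C"
    using cadlag_locally_bounded[OF assms(1), of "- real k" "real k"]
      cadlag_locally_bounded[OF assms(2), of "- real k" "real k"]
    by (auto simp: bounded_iff)
  then show ?thesis by (intro bdd_aboveI2[of _ _ "B + C"]) fastforce
qed

lemma rho_k_upper: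
  assumes "x \<in> cadlag_on UNIV" "y \<in> cadlag_on UNIV" "\<bar>s\<bar> \<le> real k"
  shows "\<bar>x s - y s\<bar> \<le> rho_k k x y"
  unfolding rho_k_def using assms(3) by (intro cSUP_upper bdd_above_rho_k assms) auto

lemma rho_k_nonneg:
  assumes "x \<in> cadlag_on UNIV" "y \<in> cadlag_on UNIV"
  shows "0 \<le> rho_k k x y"
  using rho_k_upper[OF assms, of 0 k] by simp

lemma rho_k_triangle:
  assumes "x \<in> cadlag_on UNIV" "y \<in> cadlag_on UNIV" "z \<in> cadlag_on UNIV"
  shows "rho_k k x z \<le> rho_k k x y + rho_k k y z"
proof -
  have "\<bar>x s - z s\<bar> \<le> rho_k k x y + rho_k k y z" if "s \<in> {- real k..real k}" for s
    using rho_k_upper[OF assms(1,2), of s k] rho_k_upper[OF assms(2,3), of s k] that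
    by (simp add: abs_le_iff)
  then show ?thesis unfolding rho_k_def[of k x z] by (intro cSUP_least) auto
qed

lemma frac_le_frac_add:
  fixes a b c :: real
  assumes "0 \<le> a" "0 \<le> b" "0 \<le> c" "c \<le> a + b"
  shows "c / (1 + c) \<le> a / (1 + a) + b / (1 + b)"
proof -
  have "c / (1 + c) \<le> (a + b) / (1 + (a + b))"
    using assms by (simp add: field_simps)
  also have "\<dots> = a / (1 + (a + b)) + b / (1 + (a + b))"
    by (simp add: add_divide_distrib)
  also have "\<dots> \<le> a / (1 + a) + b / (1 + b)"
    using assms by (intro add_mono divide_left_mono) auto
  finally show ?thesis .
qed

lemma summable_rho:
  assumes "x \<in> cadlag_on UNIV" "y \<in> cadlag_on UNIV"
  shows "summable (\<lambda>k. (1 / 2) ^ Suc k * (rho_k (Suc k) x y / (1 + rho_k (Suc k) x y)) :: real)"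
proof (rule summable_comparison_test')
  show "summable (\<lambda>k. (1 / 2) ^ Suc k :: real)"
    by (intro summable_Suc_iff[THEN iffD2] summable_geometric) simp
  fix k :: nat
  have "0 \<le> rho_k (Suc k) x y" by (rule rho_k_nonneg[OF assms])
  then have "0 \<le> rho_k (Suc k) x y / (1 + rho_k (Suc k) x y)"
      "rho_k (Suc k) x y / (1 + rho_k (Suc k) x y) \<le> 1"
    by (auto simp: field_simps)
  then show "norm ((1 / 2) ^ Suc k * (rho_k (Suc k) x y / (1 + rho_k (Suc k) x y)))
      \<le> (1 / 2) ^ Suc k"
    using mult_left_mono[of "rho_k (Suc k) x y / (1 + rho_k (Suc k) x y)" 1 "(1 / 2) ^ Suc k"]
    unfolding real_norm_def
    by (subst abs_of_nonneg) (simp_all only: mult_1_right zero_le_power zero_le_mult_iff, simp_all)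
qed

lemma Metric_space_D:
  "Metric_space (cadlag_on UNIV)
     (\<lambda>x y. if x \<in> cadlag_on UNIV \<and> y \<in> cadlag_on UNIV then rho x y else 0)"
  (is "Metric_space ?D ?d")
proof
  have term_nonneg: "0 \<le> (1 / 2) ^ Suc k * (rho_k (Suc k) x y / (1 + rho_k (Suc k) x y))"
    if "x \<in> ?D" "y \<in> ?D" for x y k
    using rho_k_nonneg[OF that] by simp
  show "0 \<le> ?d x y" for x y
    using suminf_nonneg[OF summable_rho term_nonneg, of x y] by (simp add: rho_def del: power_Suc)
  show "?d x y = ?d y x" for x y
    by (simp add: rho_def rho_k_def abs_minus_commute)
  show "?d x y = 0 \<longleftrightarrow> x = y" if D: "x \<in> ?D" "y \<in> ?D" for x y
  proof
    assume "x = y"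
    then show "?d x y = 0" by (simp add: rho_def rho_k_def)
  next
    assume "?d x y = 0"
    then have 0: "rho x y = 0" using D by simp
    have terms: "(1 / 2) ^ Suc k * (rho_k (Suc k) x y / (1 + rho_k (Suc k) x y)) = 0" for k
      using 0 suminf_eq_zero_iff[OF summable_rho[OF D] term_nonneg[OF D]]
      unfolding rho_def by blast
    have zero: "rho_k (Suc k) x y = 0" for k
      using terms[of k] rho_k_nonneg[OF D, of "Suc k"] by auto
    show "x = y"
    proof
      fix s
      obtain k where "\<bar>s\<bar> \<le> real k" using real_arch_simple by blast
      then have "\<bar>s\<bar> \<le> real (Suc k)" by simp
      then show "x s = y s" using rho_k_upper[OF D, of s "Suc k"] zero[of k] by simp
    qed
  qed
  show "?d x z \<le> ?d x y + ?d y z" if D: "x \<in> ?D" "y \<in> ?D" "z \<in> ?D" for x y z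
  proof -
    let ?t = "\<lambda>x y k. (1 / 2) ^ Suc k * (rho_k (Suc k) x y / (1 + rho_k (Suc k) x y)) :: real"
    have "?t x z k \<le> ?t x y k + ?t y z k" for k
      using frac_le_frac_add[OF rho_k_nonneg[OF D(1,2)] rho_k_nonneg[OF D(2,3)]
          rho_k_nonneg[OF D(1,3)] rho_k_triangle[OF D]]
      unfolding distrib_left[symmetric] by (intro mult_left_mono) auto
    then have "suminf (?t x z) \<le> (\<Sum>k. ?t x y k + ?t y z k)"
      by (intro suminf_le summable_add summable_rho D)
    also have "\<dots> = suminf (?t x y) + suminf (?t y z)"
      by (intro suminf_add[symmetric] summable_rho D)
    finally show ?thesis using D by (simp add: rho_def)
  qed
qed

lemma mspace_D_metric [simp]: "mspace D_metric = cadlag_on UNIV"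
  unfolding D_metric_def by (rule Metric_space.mspace_metric[OF Metric_space_D])

lemma mdist_D_metric:
  "x \<in> cadlag_on UNIV \<Longrightarrow> y \<in> cadlag_on UNIV \<Longrightarrow> mdist D_metric x y = rho x y"
  unfolding D_metric_def by (simp add: Metric_space.mdist_metric[OF Metric_space_D])


section \<open>Weak convergence in a metric space with a sigma-algebra\<close>

text \<open>
  Convergence in law in the sense of Pollard: the test functions are the bounded continuous
  functions that are measurable for the given \<open>\<sigma>\<close>-algebra, which may be smaller than the Borel one.
\<close>

definition converges_in_law ::
  "'b metric \<Rightarrow> 'b measure \<Rightarrow> (nat \<Rightarrow> 'a measure) \<Rightarrow> (nat \<Rightarrow> 'a \<Rightarrow> 'b) \<Rightarrow>
   'c measure \<Rightarrow> ('c \<Rightarrow> 'b) \<Rightarrow> bool" where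
  "converges_in_law m \<A> M X N Y \<longleftrightarrow>
     (\<forall>n. X n \<in> measurable (M n) \<A>) \<and> Y \<in> measurable N \<A> \<and>
     (\<forall>f :: 'b \<Rightarrow> real.
        continuous_map (mtopology_of m) euclidean f \<and> f \<in> borel_measurable \<A> \<and>
        (\<exists>B. \<forall>x\<in>mspace m. \<bar>f x\<bar> \<le> B) \<longrightarrow>
        (\<lambda>n. \<integral>\<omega>. f (X n \<omega>) \<partial>M n) \<longlonglongrightarrow> (\<integral>\<omega>. f (Y \<omega>) \<partial>N))"

definition completely_regular_point :: "'a metric \<Rightarrow> 'a measure \<Rightarrow> 'a \<Rightarrow> bool" where
  "completely_regular_point m \<A> x \<longleftrightarrow>
     x \<in> mspace m \<and>
     (\<forall>V. V \<subseteq> mspace m \<and> (\<exists>U. openin (mtopology_of m) U \<and> x \<in> U \<and> U \<subseteq> V) \<longrightarrow>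
        (\<exists>g :: 'a \<Rightarrow> real. uniformly_continuous_map m euclidean_metric g \<and>
           g \<in> borel_measurable \<A> \<and> g x = 1 \<and> (\<forall>z\<in>mspace m. g z \<le> indicator V z)))"

definition cadlag_process :: "'a measure \<Rightarrow> real set \<Rightarrow> ('a \<Rightarrow> real \<Rightarrow> real) \<Rightarrow> bool" where
  "cadlag_process M J v \<longleftrightarrow>
     (\<forall>t\<in>J. (\<lambda>\<omega>. v \<omega> t) \<in> borel_measurable M) \<and> (\<forall>\<omega>\<in>space M. v \<omega> \<in> cadlag_on J)"


section \<open>Greatest convex minorants and rescaling\<close>

definition gcm :: "real set \<Rightarrow> (real \<Rightarrow> real) \<Rightarrow> real \<Rightarrow> real" where
  "gcm I x t = Sup {z t | z. convex_on I z \<and> (\<forall>s\<in>I. z s \<le> x s)}"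

definition right_deriv :: "(real \<Rightarrow> real) \<Rightarrow> real \<Rightarrow> real" where
  "right_deriv f t = (THE l. (f has_real_derivative l) (at_right t))"

definition rescaled_interval :: "real set \<Rightarrow> real \<Rightarrow> real \<Rightarrow> real set" where
  "rescaled_interval J t\<^sub>0 \<delta> = (\<lambda>t. (t - t\<^sub>0) / \<delta>) ` J"

definition rescaled_noise :: "real \<Rightarrow> real \<Rightarrow> real \<Rightarrow> (real \<Rightarrow> real) \<Rightarrow> real \<Rightarrow> real" where
  "rescaled_noise p \<delta> t\<^sub>0 v s = \<delta> powr (- p) * (v (t\<^sub>0 + s * \<delta>) - v t\<^sub>0)"

text \<open>
  The derivative of the convex drift is the right-hand derivative, which exists at every interior
  point, so that drifts with a kink at \<open>t\<^sub>0\<close> (such as piecewise linear ones) are allowed.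
\<close>

definition rescaled_drift :: "real \<Rightarrow> real \<Rightarrow> real \<Rightarrow> (real \<Rightarrow> real) \<Rightarrow> real \<Rightarrow> real" where
  "rescaled_drift p \<delta> t\<^sub>0 x\<^sub>b s =
     \<delta> powr (- p) * (x\<^sub>b (t\<^sub>0 + s * \<delta>) - x\<^sub>b t\<^sub>0 - right_deriv x\<^sub>b t\<^sub>0 * (s * \<delta>))"

text \<open>
  Extension of a function from an interval to the real line by constants.  At an endpoint that
  does not belong to the interval the constant is the one-sided limit, if it exists.
\<close>

definition const_extension :: "real set \<Rightarrow> (real \<Rightarrow> real) \<Rightarrow> real \<Rightarrow> real" where
  "const_extension I h s =
     (if s \<in> I then h s
      else if \<forall>u\<in>I. u < s then (if Sup I \<in> I then h (Sup I) else Lim (at_left (Sup I)) h)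
      else (if Inf I \<in> I then h (Inf I) else Lim (at_right (Inf I)) h))"

end

theory Submission
  imports Defs
begin

text \<open>
  Let \<open>f\<close> be the greatest convex minorant of \<open>x\<close> on \<open>I\<close> and \<open>m\<close> its right derivative at an interior
  point \<open>t\<close>.  Then \<open>m < a\<close> holds iff \<open>x s < f t + a (s - t)\<close> for some \<open>s > t\<close>, since otherwise the
  maximum of \<open>f\<close> and the line of slope \<open>a\<close> through \<open>(t, f t)\<close> would be a larger convex minorant.  A
  strict inequality at one point survives small uniform perturbations, so \<open>m\<close> is upper
  semicontinuous; without kinks of \<open>x\<close> at \<open>t\<close> it is also lower semicontinuous.  The distances to
  the points of a countable set that is dense in the support of the limit are measurable for the
  ball \<open>\<sigma>\<close>-algebra and give enough test functions to transfer lower bounds for the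
  probabilities of \<open>m < a\<close> and \<open>m > a\<close> from the limit to the sequence.
\<close>

section \<open>Slopes of greatest convex minorants\<close>

lemma bdd_above_convex_minorants:
  assumes "t \<in> I"
  shows "bdd_above {z t | z. convex_on I z \<and> (\<forall>s\<in>I. z s \<le> x s)}"
  using assms by (intro bdd_aboveI[of _ "x t"]) auto

lemma gcm_greatest:
  assumes "convex_on I z" "\<And>s. s \<in> I \<Longrightarrow> z s \<le> x s" "t \<in> I"
  shows "z t \<le> gcm I x t"
  unfolding gcm_def using assms by (intro cSup_upper bdd_above_convex_minorants) auto

text \<open>A constant lower bound of \<open>x\<close> is itself a convex minorant. Bounds on
  \<open>gcm\<close> through \<open>cSup_least\<close> rest on this, since the supremum of an empty
  set of reals carries no information.\<close>

lemma convex_minorants_nonempty: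
  assumes "convex I" "bdd_below (x ` I)"
  shows "{z t | z. convex_on I z \<and> (\<forall>s\<in>I. z s \<le> x s)} \<noteq> {}"
proof -
  obtain b where "\<And>s. s \<in> I \<Longrightarrow> b \<le> x s"
    using assms(2) by (auto simp: bdd_below_def)
  then have "convex_on I (\<lambda>_. b) \<and> (\<forall>s\<in>I. b \<le> x s)"
    using assms(1) by (auto simp: convex_on_const)
  then show ?thesis by blast
qed

lemma gcm_le:
  assumes "convex I" "bdd_below (x ` I)" "t \<in> I"
  shows "gcm I x t \<le> x t"
  unfolding gcm_def using assms by (intro cSup_least convex_minorants_nonempty) auto

lemma convex_on_gcm:
  assumes "convex I" "bdd_below (x ` I)"
  shows "convex_on I (gcm I x)"
proof (rule convex_onI[OF _ assms(1)])
  fix u a b :: real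
  assume u: "0 < u" "u < 1" and ab: "a \<in> I" "b \<in> I"
  show "gcm I x ((1 - u) *\<^sub>R a + u *\<^sub>R b) \<le> (1 - u) * gcm I x a + u * gcm I x b"
    unfolding gcm_def[of I x "(1 - u) *\<^sub>R a + u *\<^sub>R b"]
  proof (rule cSup_least[OF convex_minorants_nonempty[OF assms]])
    fix r assume "r \<in> {z ((1 - u) *\<^sub>R a + u *\<^sub>R b) | z. convex_on I z \<and> (\<forall>s\<in>I. z s \<le> x s)}"
    then obtain z where z: "r = z ((1 - u) *\<^sub>R a + u *\<^sub>R b)" "convex_on I z" "\<And>s. s \<in> I \<Longrightarrow> z s \<le> x s"
      by auto
    have "r \<le> (1 - u) * z a + u * z b"
      unfolding z(1) using convex_onD[OF z(2)] u ab by simp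
    also have "\<dots> \<le> (1 - u) * gcm I x a + u * gcm I x b"
      using gcm_greatest[OF z(2,3)] u ab by (intro add_mono mult_left_mono) auto
    finally show "r \<le> (1 - u) * gcm I x a + u * gcm I x b" .
  qed
qed

text \<open>The slopes of the chords from \<open>t\<close> decrease as \<open>s\<close> decreases to
  \<open>t\<close>, so their limit is their infimum. The value is kept as an explicit
  \<open>Inf\<close> because the supporting line of \<open>convex_le_Inf_differential\<close> has
  this slope.\<close>

lemma convex_on_has_right_derivative:
  fixes f :: "real \<Rightarrow> real"
  assumes f: "convex_on I f" and t: "t \<in> interior I"
  shows "(f has_real_derivative Inf ((\<lambda>s. (f t - f s) / (t - s)) ` ({t<..} \<inter> I))) (at_right t)"
    (is "(_ has_real_derivative ?m) _")
proof -
  obtain e where e: "0 < e" "ball t e \<subseteq> I"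
    using t by (meson mem_interior)
  have tI: "t \<in> I" using t interior_subset by blast
  have near: "eventually (\<lambda>s. s \<in> I \<and> t < s) (at_right t)"
    using e by (auto simp: eventually_at dist_real_def subset_iff intro!: exI[of _ e])
  have "((\<lambda>s. (f s - f t) / (s - t)) \<longlongrightarrow> ?m) (at_right t)"
  proof (rule order_tendstoI)
    fix a assume a: "a < ?m"
    show "\<forall>\<^sub>F s in at_right t. a < (f s - f t) / (s - t)"
      using near
    proof eventually_elim
      case (elim s)
      then have "f t + ?m * (s - t) \<le> f s"
        using convex_le_Inf_differential[OF f t] by simp
      moreover have "a * (s - t) < ?m * (s - t)" using a elim by simp
      ultimately have "a * (s - t) < f s - f t" by linarith
      then show ?case using elim by (subst pos_less_divide_eq) auto
    qed
  next
    fix a assume "?m < a"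
    moreover have "t + e / 2 \<in> {t<..} \<inter> I" using e by (auto simp: dist_real_def subset_iff)
    \<comment> \<open>One chord of slope below \<open>a\<close> suffices: chords to points between
      \<open>t\<close> and \<open>u\<close> are no steeper.\<close>
    ultimately obtain u where u: "u \<in> I" "t < u" "(f t - f u) / (t - u) < a"
      using cInf_lessD[of "(\<lambda>s. (f t - f s) / (t - s)) ` ({t<..} \<inter> I)" a] by blast

    have "\<forall>\<^sub>F s in at_right t. s < u"
      using u(2) unfolding eventually_at_right_field by blast
    with near show "\<forall>\<^sub>F s in at_right t. (f s - f t) / (s - t) < a"
    proof eventually_elim
      case (elim s)
      then have "(f t - f s) / (t - s) \<le> (f t - f u) / (t - u)"
        using convex_on_slope_le(1)[OF f tI u(1), of s] by simp
      also have "\<dots> < a" by (rule u(3))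
      finally show ?case by (metis minus_diff_eq minus_divide_divide)
    qed
  qed
  then show ?thesis by (simp add: has_field_derivative_iff)
qed

lemma right_deriv_eq:
  assumes "(f has_real_derivative m) (at_right t)"
  shows "right_deriv f t = m"
  unfolding right_deriv_def
proof (rule the_equality)
  show "l = m" if "(f has_real_derivative l) (at_right t)" for l
    using that assms unfolding has_field_derivative_iff
    by (rule tendsto_unique[OF trivial_limit_at_right_real])
qed (rule assms)

lemma gcm_has_right_derivative:
  assumes "convex I" "t \<in> interior I" "bdd_below (x ` I)"
  shows "(gcm I x has_real_derivative right_deriv (gcm I x) t) (at_right t)"
  using convex_on_has_right_derivative[OF convex_on_gcm[OF assms(1,3)] assms(2)] right_deriv_eq
  by metis

text \<open>The right derivative is the infimum of the chord slopes, hence a subgradient. The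
  inequality is used on both sides of \<open>t\<close>.\<close>

lemma gcm_support_line:
  assumes "convex I" "t \<in> interior I" "bdd_below (x ` I)" "s \<in> I"
  shows "gcm I x t + right_deriv (gcm I x) t * (s - t) \<le> gcm I x s"
  using convex_le_Inf_differential[OF convex_on_gcm[OF assms(1,3)] assms(2,4)]
    right_deriv_eq[OF convex_on_has_right_derivative[OF convex_on_gcm[OF assms(1,3)] assms(2)]]
  by simp

text \<open>Supplies the competitor that contradicts maximality when a line through the minorant
  stays below \<open>x\<close>.\<close>

lemma convex_on_max_affine:
  fixes f :: "real \<Rightarrow> real"
  assumes "convex_on I f"
  shows "convex_on I (\<lambda>s. max (f s) (b + a * s))"
proof (rule convex_onI[OF _ convex_on_imp_convex[OF assms]])
  fix u r s :: real
  assume u: "0 < u" "u < 1" and I: "r \<in> I" "s \<in> I"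
  have "f ((1 - u) *\<^sub>R r + u *\<^sub>R s) \<le> (1 - u) * f r + u * f s"
    using convex_onD[OF assms] u I by simp
  also have "\<dots> \<le> (1 - u) * max (f r) (b + a * r) + u * max (f s) (b + a * s)"
    using u by (intro add_mono mult_left_mono) auto
  finally have 1: "f ((1 - u) *\<^sub>R r + u *\<^sub>R s) \<le> \<dots>" .
  have "b + a * ((1 - u) *\<^sub>R r + u *\<^sub>R s) = (1 - u) * (b + a * r) + u * (b + a * s)"
    by (simp add: algebra_simps)
  also have "\<dots> \<le> (1 - u) * max (f r) (b + a * r) + u * max (f s) (b + a * s)"
    using u by (intro add_mono mult_left_mono) auto
  finally show "max (f ((1 - u) *\<^sub>R r + u *\<^sub>R s)) (b + a * ((1 - u) *\<^sub>R r + u *\<^sub>R s))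
      \<le> (1 - u) * max (f r) (b + a * r) + u * max (f s) (b + a * s)"
    using 1 by simp
qed

lemma right_deriv_gcm_less_iff:
  assumes I: "convex I" "t \<in> interior I" and x: "bdd_below (x ` I)"
  shows "right_deriv (gcm I x) t < a \<longleftrightarrow> (\<exists>s\<in>I. t < s \<and> x s < gcm I x t + a * (s - t))"
proof
  let ?f = "gcm I x"
  assume less: "right_deriv ?f t < a"
  show "\<exists>s\<in>I. t < s \<and> x s < ?f t + a * (s - t)"
  proof (rule ccontr)
    assume "\<not> ?thesis"
    then have above: "\<And>s. s \<in> I \<Longrightarrow> t < s \<Longrightarrow> ?f t + a * (s - t) \<le> x s" by force
    have cvx: "convex_on I (\<lambda>s. max (?f s) ((?f t - a * t) + a * s))"
      by (rule convex_on_max_affine[OF convex_on_gcm[OF I(1) x]])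
    have minorant: "max (?f s) ((?f t - a * t) + a * s) \<le> x s" if s: "s \<in> I" for s
    proof (cases "t < s")
      case True
      then show ?thesis
        using above[OF s True] gcm_le[OF I(1) x s] by (simp add: algebra_simps)
    next
      case False
      \<comment> \<open>Left of \<open>t\<close> the factor \<open>s - t\<close> is not positive, so
        the line of larger slope \<open>a\<close> lies below the supporting line.\<close>
      then have "a * (s - t) \<le> right_deriv ?f t * (s - t)"
        using less by (intro mult_right_mono_neg) auto
      then show ?thesis
        using gcm_support_line[OF I x s] gcm_le[OF I(1) x s] by (simp add: algebra_simps)
    qed
    \<comment> \<open>Maximality puts the line of slope \<open>a\<close> below \<open>?f\<close>,
      and the difference quotients then push the right derivative up to \<open>a\<close>.\<close>
    have "?f t + a * (s - t) \<le> ?f s" if "s \<in> I" for s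
      using gcm_greatest[OF cvx minorant that] by (simp add: algebra_simps)
    moreover have "eventually (\<lambda>s. s \<in> I \<and> t < s) (at_right t)"
      using I(2) by (auto simp: eventually_at dist_real_def subset_iff mem_interior)
    ultimately have "eventually (\<lambda>s. a \<le> (?f s - ?f t) / (s - t)) (at_right t)"
      by (auto elim!: eventually_mono simp: pos_le_divide_eq le_diff_eq add.commute)
    then have "a \<le> right_deriv ?f t"
      using gcm_has_right_derivative[OF I x] unfolding has_field_derivative_iff
      by (intro tendsto_lowerbound[OF _ _ trivial_limit_at_right_real])
    then show False using less by simp
  qed
next
  assume "\<exists>s\<in>I. t < s \<and> x s < gcm I x t + a * (s - t)"
  then obtain s where s: "s \<in> I" "t < s" "x s < gcm I x t + a * (s - t)" by blast
  have "gcm I x t + right_deriv (gcm I x) t * (s - t) < gcm I x t + a * (s - t)"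
    using gcm_support_line[OF I x s(1)] gcm_le[OF I(1) x s(1)] s(3) by linarith
  then show "right_deriv (gcm I x) t < a" using s(2) by simp
qed

text \<open>Lowering the minorant of \<open>x\<close> by \<open>\<delta>\<close> gives a convex
  minorant of \<open>w\<close>. Applied in both directions, this makes the minorant at
  \<open>t\<close> move no more than the function does in the uniform norm.\<close>

lemma gcm_mono_add:
  assumes "convex I" "bdd_below (x ` I)" "t \<in> I" "\<And>s. s \<in> I \<Longrightarrow> x s \<le> w s + \<delta>"
  shows "gcm I x t \<le> gcm I w t + \<delta>"
proof -
  have "convex_on I (\<lambda>s. gcm I x s + (- \<delta>))"
    by (intro convex_on_add convex_on_gcm assms) (simp add: convex_on_const assms)
  then have "gcm I x t + (- \<delta>) \<le> gcm I w t"
    by (rule gcm_greatest) (use gcm_le[OF assms(1,2)] assms(3,4) in \<open>fastforce+\<close>)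
  then show ?thesis by simp
qed

lemma bdd_below_image_close:
  fixes x w :: "'a \<Rightarrow> real"
  assumes "bdd_below (x ` I)" "\<forall>s\<in>I. \<bar>w s - x s\<bar> \<le> \<delta>"
  shows "bdd_below (w ` I)"
proof -
  obtain b where "\<And>s. s \<in> I \<Longrightarrow> b \<le> x s"
    using assms(1) by (auto simp: bdd_below_def)
  then show ?thesis
    using assms(2) by (intro bdd_belowI2[of _ "b - \<delta>"]) fastforce
qed

lemma right_deriv_gcm_upper_semicontinuous:
  assumes I: "convex I" "t \<in> interior I" and x: "bdd_below (x ` I)"
    and a: "right_deriv (gcm I x) t < a"
  shows "\<exists>\<delta>>0. \<forall>w. (\<forall>s\<in>I. \<bar>w s - x s\<bar> \<le> \<delta>) \<longrightarrow> right_deriv (gcm I w) t < a"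
proof -
  obtain s where s: "s \<in> I" "t < s" "x s < gcm I x t + a * (s - t)"
    using right_deriv_gcm_less_iff[OF I x] a by blast
  \<comment> \<open>A third of the gap: \<open>x s\<close> and the minorant at \<open>t\<close> may
    each move by \<open>\<delta>\<close>, and the remaining third keeps the inequality
    strict.\<close>
  define \<delta> where "\<delta> = (gcm I x t + a * (s - t) - x s) / 3"
  have \<delta>: "\<delta> > 0" using s by (simp add: \<delta>_def)
  have "right_deriv (gcm I w) t < a" if w: "\<forall>s\<in>I. \<bar>w s - x s\<bar> \<le> \<delta>" for w
  proof -
    have "gcm I x t \<le> gcm I w t + \<delta>"
      using I interior_subset w by (intro gcm_mono_add x) (force simp: abs_le_iff)+
    moreover have "w s \<le> x s + \<delta>" using w s(1) by (force simp: abs_le_iff)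
    ultimately have "w s < gcm I w t + a * (s - t)"
      using \<delta> s(3) unfolding \<delta>_def by argo
    moreover have "bdd_below (w ` I)"
      using bdd_below_image_close[OF x w] .
    ultimately show ?thesis using right_deriv_gcm_less_iff[OF I] s(1,2) by blast
  qed
  then show ?thesis using \<delta> by blast
qed

text \<open>
  If \<open>x t\<close> exceeds the minorant at \<open>t\<close>, then by right continuity the minorant stays away from \<open>x\<close>
  just to the right of \<open>t\<close>, so only points bounded away from \<open>t\<close> constrain the right slope.
  Otherwise \<open>x t = gcm I x t\<close> and the absence of a kink gives a point on the left of \<open>t\<close> below the
  line of slope \<open>a\<close>.
\<close>

lemma right_deriv_gcm_lower_semicontinuous:
  assumes I: "convex I" "t \<in> interior I" and x: "bdd_below (x ` I)"
    and rc: "(x \<longlongrightarrow> x t) (at_right t)"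
    and no_kink: "\<And>a \<epsilon>. 0 < \<epsilon> \<Longrightarrow> \<exists>s\<in>I. x s - x t - a * (s - t) < \<epsilon> * \<bar>s - t\<bar>"
    and a: "a < right_deriv (gcm I x) t"
  shows "\<exists>\<delta>>0. \<forall>w. (\<forall>s\<in>I. \<bar>w s - x s\<bar> \<le> \<delta>) \<longrightarrow> a < right_deriv (gcm I w) t"
proof -
  let ?f = "gcm I x"
  define m where "m = right_deriv ?f t"
  \<comment> \<open>The criterion for the slope yields only a weak bound by \<open>b\<close>;
    placing \<open>b\<close> strictly above \<open>a\<close> makes the conclusion strict.\<close>
  define b where "b = (a + m) / 2"
  have b: "a < b" "b < m" using a by (auto simp: b_def m_def)
  have tI: "t \<in> I" using I(2) interior_subset by blast
  have line: "?f t + m * (s - t) \<le> x s" if "s \<in> I" for s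
    using gcm_support_line[OF I x that] gcm_le[OF I(1) x that] by (simp add: m_def)
  have gcm_close: "gcm I w t \<le> ?f t + \<delta>" "?f t \<le> gcm I w t + \<delta>"
    if "\<forall>s\<in>I. \<bar>w s - x s\<bar> \<le> \<delta>" for w \<delta>
    using that bdd_below_image_close[OF x that]
    by (auto intro!: gcm_mono_add I(1) tI x simp: abs_le_iff)
  show ?thesis
  proof (cases "?f t < x t")
    case True
    \<comment> \<open>A quarter of the gap for each of four errors: the variation of
      \<open>x\<close> to the right of \<open>t\<close>, the term \<open>b * (s - t)\<close>, and
      the perturbations of \<open>x\<close> and of the minorant.\<close>
    define \<gamma> where "\<gamma> = (x t - ?f t) / 4"
    have \<gamma>: "0 < \<gamma>" using True by (simp add: \<gamma>_def)
    have "eventually (\<lambda>s. x t - \<gamma> < x s) (at_right t)"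
      using \<gamma> by (intro order_tendstoD[OF rc]) simp
    moreover have "((\<lambda>s. b * (s - t)) \<longlongrightarrow> b * (t - t)) (at_right t)"
      by (intro tendsto_intros)
    then have "eventually (\<lambda>s. b * (s - t) < \<gamma>) (at_right t)"
      using \<gamma> by (intro order_tendstoD) auto
    ultimately have "eventually (\<lambda>s. x t - \<gamma> < x s \<and> b * (s - t) < \<gamma>) (at_right t)"
      by eventually_elim simp
    then obtain h where h: "t < h"
      "\<And>s. t < s \<Longrightarrow> s < h \<Longrightarrow> x t - \<gamma> < x s \<and> b * (s - t) < \<gamma>"
      unfolding eventually_at_right_field by blast
    \<comment> \<open>The bound by \<open>\<gamma>\<close> serves the points before
      \<open>h\<close>. From \<open>h\<close> on, lines of slopes \<open>m\<close> and
      \<open>b\<close> through the same point differ by at least \<open>(m - b) * (h - t)\<close>,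
      which absorbs \<open>\<delta>\<close> twice.\<close>
    define \<delta> where "\<delta> = min \<gamma> ((m - b) * (h - t) / 2)"
    have \<delta>: "0 < \<delta>" using \<gamma> b h by (auto simp: \<delta>_def)
    have "a < right_deriv (gcm I w) t" if w: "\<forall>s\<in>I. \<bar>w s - x s\<bar> \<le> \<delta>" for w
    proof -
      have "gcm I w t + b * (s - t) \<le> w s" if s: "s \<in> I" "t < s" for s
      proof (cases "s < h")
        case True
        have "w s \<ge> x s - \<delta>" using bspec[OF w s(1)] by (simp add: abs_le_iff)
        moreover have "\<delta> \<le> \<gamma>" by (simp add: \<delta>_def)
        ultimately show ?thesis
          using h(2)[OF s(2) True] gcm_close(1)[OF w] \<gamma>_def by argo
      next
        case False
        have "w s \<ge> x s - \<delta>" using bspec[OF w s(1)] by (simp add: abs_le_iff)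
        moreover have "2 * \<delta> \<le> (m - b) * (h - t)" by (simp add: \<delta>_def)
        moreover have "(m - b) * (h - t) \<le> (m - b) * (s - t)"
          using b False by (intro mult_left_mono) auto
        ultimately show ?thesis
          using line[OF s(1)] gcm_close(1)[OF w] by (simp add: algebra_simps)
      qed
      then have "\<not> right_deriv (gcm I w) t < b"
        using right_deriv_gcm_less_iff[OF I bdd_below_image_close[OF x w]] by force
      then show ?thesis using b by simp
    qed
    then show ?thesis using \<delta> by blast
  next
    case False
    then have xt: "x t = ?f t" using gcm_le[OF I(1) x tI] by simp
    have "\<exists>s\<in>I. s < t \<and> x s < ?f t + b * (s - t)"
    proof -
      \<comment> \<open>With the midpoint of \<open>b\<close> and \<open>m\<close> as slope and half
        their distance as tolerance, the inequality reads slope \<open>m\<close> right of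
        \<open>t\<close> and slope \<open>b\<close> left of it. The first contradicts the supporting
        line, so \<open>s\<close> lies on the left.\<close>
      obtain s where s: "s \<in> I" "x s - x t - (b + m) / 2 * (s - t) < (m - b) / 2 * \<bar>s - t\<bar>"
        using no_kink[of "(m - b) / 2" "(b + m) / 2"] b by auto
      have "s < t"
      proof (rule ccontr)
        assume "\<not> s < t"
        then have "x s - x t < m * (s - t)"
          using s(2) by (simp add: field_simps)
        then show False using line[OF s(1)] xt by simp
      qed
      moreover from this have "x s - x t < b * (s - t)"
        using s(2) by (simp add: field_simps)
      ultimately show ?thesis using s(1) xt by auto
    qed
    then obtain s where s: "s \<in> I" "s < t" "x s < ?f t + b * (s - t)" by blast
    define \<delta> where "\<delta> = (?f t + b * (s - t) - x s) / 3"
    have \<delta>: "0 < \<delta>" using s by (simp add: \<delta>_def)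
    have "a < right_deriv (gcm I w) t" if w: "\<forall>s\<in>I. \<bar>w s - x s\<bar> \<le> \<delta>" for w
    proof -
      have w': "bdd_below (w ` I)" by (rule bdd_below_image_close[OF x w])
      have "w s \<le> x s + \<delta>" using w s(1) by (force simp: abs_le_iff)
      then have "w s < gcm I w t + b * (s - t)"
        using \<delta> gcm_close(2)[OF w] unfolding \<delta>_def by argo
      \<comment> \<open>Here \<open>s - t\<close> is negative, so a point on the left bounds the
        slope from below.\<close>
      then have "right_deriv (gcm I w) t * (s - t) < b * (s - t)"
        using gcm_support_line[OF I w' s(1)] gcm_le[OF I(1) w' s(1)] by linarith
      then show ?thesis using s(2) b by (simp add: mult_less_cancel_right)
    qed
    then show ?thesis using \<delta> by blast
  qed
qed

text \<open>Affine minorants with rational coefficients suffice because on a bounded interval a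
  supporting line can be replaced by a nearby rational one. The condition is thus countable apart
  from the quantifier over \<open>s\<close>, whose form suits
  \<open>pred_right_continuous_nonneg\<close>.\<close>

lemma gcm_greater_iff:
  assumes I: "convex I" "bounded I" "t \<in> interior I" and x: "bdd_below (x ` I)"
  shows "b < gcm I x t \<longleftrightarrow>
    (\<exists>q\<in>\<rat>. \<exists>r\<in>\<rat>. b < r + q * t \<and> (\<forall>s\<in>I. 0 \<le> x s - (r + q * s)))"
proof
  assume less: "b < gcm I x t"
  define m where "m = right_deriv (gcm I x) t"
  obtain B where B: "0 < B" "\<And>s. s \<in> I \<Longrightarrow> \<bar>s - t\<bar> \<le> B"
  proof -
    obtain C where "\<forall>s\<in>I. \<bar>s\<bar> \<le> C" using I(2) by (auto simp: bounded_iff)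
    then show thesis by (intro that[of "\<bar>C\<bar> + \<bar>t\<bar> + 1"]) force+
  qed
  define e where "e = (gcm I x t - b) / 4"
  have e: "0 < e" using less by (simp add: e_def)
  \<comment> \<open>Since \<open>\<bar>s - t\<bar>\<close> is at most \<open>B\<close>, a slope
    error below \<open>e / B\<close> costs at most \<open>e\<close> on \<open>I\<close>. The choice
    of \<open>r\<close> costs another \<open>e\<close>, well within the gap
    \<open>4 * e\<close>.\<close>
  obtain q where q: "q \<in> \<rat>" "m - e / B < q" "q < m + e / B"
    using Rats_dense_in_real[of "m - e / B" "m + e / B"] divide_pos_pos[OF e B(1)] by auto
  obtain r where r: "r \<in> \<rat>" "b - q * t < r" "r < b - q * t + e"
    using Rats_dense_in_real[of "b - q * t" "b - q * t + e"] e by auto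
  have "0 \<le> x s - (r + q * s)" if s: "s \<in> I" for s
  proof -
    have "\<bar>(q - m) * (s - t)\<bar> \<le> e / B * B"
      unfolding abs_mult using q B e s by (intro mult_mono) (auto simp: abs_le_iff)
    then have "(q - m) * (s - t) \<le> e" using B(1) by simp
    moreover have "gcm I x t + m * (s - t) \<le> x s"
      using gcm_support_line[OF I(1,3) x s] gcm_le[OF I(1) x s] by (simp add: m_def)
    moreover have "gcm I x t = b + 4 * e" by (simp add: e_def field_simps)
    moreover have "r + q * s = (r + q * t) + (q - m) * (s - t) + m * (s - t)"
      by (simp add: algebra_simps)
    ultimately show ?thesis using r(3) e by linarith
  qed
  then show "\<exists>q\<in>\<rat>. \<exists>r\<in>\<rat>. b < r + q * t \<and> (\<forall>s\<in>I. 0 \<le> x s - (r + q * s))"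
    using q r by (intro bexI[of _ q] bexI[of _ r]) auto
next
  assume "\<exists>q\<in>\<rat>. \<exists>r\<in>\<rat>. b < r + q * t \<and> (\<forall>s\<in>I. 0 \<le> x s - (r + q * s))"
  then obtain q r where qr: "b < r + q * t" "\<forall>s\<in>I. 0 \<le> x s - (r + q * s)" by blast
  have "convex_on I (\<lambda>s. r + q * s)"
    using I(1) by (auto simp: convex_on_def algebra_simps simp flip: distrib_right)
  then have "r + q * t \<le> gcm I x t"
    by (rule gcm_greatest) (use qr I(3) interior_subset in auto)
  then show "b < gcm I x t" using qr by simp
qed

section \<open>Measurability of the slope\<close>

text \<open>A negative value before \<open>u\<close> persists on an interval to its right and so
  reaches a rational. Nothing in the interval lies to the right of \<open>u\<close>, which is
  therefore added to the test points.\<close>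

lemma right_continuous_nonneg_iff_dense:
  fixes z :: "real \<Rightarrow> real"
  assumes rc: "\<And>s. l \<le> s \<Longrightarrow> s < u \<Longrightarrow> (z \<longlongrightarrow> z s) (at_right s)"
  shows "(\<forall>s\<in>{l..u}. 0 \<le> z s) \<longleftrightarrow> (\<forall>s\<in>{l..u} \<inter> insert u \<rat>. 0 \<le> z s)"
proof
  assume dense: "\<forall>s\<in>{l..u} \<inter> insert u \<rat>. 0 \<le> z s"
  show "\<forall>s\<in>{l..u}. 0 \<le> z s"
  proof (rule ballI, rule ccontr)
    fix s assume s: "s \<in> {l..u}" "\<not> 0 \<le> z s"
    then have "s \<noteq> u" using dense by auto
    then have s': "l \<le> s" "s < u" using s by auto
    have "\<forall>\<^sub>F r in at_right s. z r < 0"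
      using s by (intro order_tendstoD(2)[OF rc[OF s']]) auto
    then obtain b where b: "s < b" "\<And>r. s < r \<Longrightarrow> r < b \<Longrightarrow> z r < 0"
      unfolding eventually_at_right_field by blast
    obtain q where "q \<in> \<rat>" "s < q" "q < min b u"
      using Rats_dense_in_real[of s "min b u"] b(1) s'(2) by auto
    then have "q \<in> {l..u} \<inter> insert u \<rat>" "z q < 0" using b(2) s'(1) by auto
    then show False using dense by force
  qed
qed auto

lemma pred_right_continuous_nonneg:
  fixes Z :: "'a \<Rightarrow> real \<Rightarrow> real"
  assumes meas: "\<And>s. s \<in> {l..u} \<Longrightarrow> (\<lambda>\<omega>. Z \<omega> s) \<in> borel_measurable M"
    and rc: "\<And>\<omega> s. \<omega> \<in> space M \<Longrightarrow> l \<le> s \<Longrightarrow> s < u \<Longrightarrow> (Z \<omega> \<longlongrightarrow> Z \<omega> s) (at_right s)"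
  shows "Measurable.pred M (\<lambda>\<omega>. \<forall>s\<in>{l..u}. 0 \<le> Z \<omega> s)"
proof -
  have "countable ({l..u} \<inter> insert u \<rat>)" by (simp add: countable_rat countable_Int2)
  then have "Measurable.pred M (\<lambda>\<omega>. \<forall>s\<in>{l..u} \<inter> insert u \<rat>. 0 \<le> Z \<omega> s)"
    using meas by (intro measurable_pred_countable(1)) auto
  then show ?thesis
    using right_continuous_nonneg_iff_dense[OF rc] by (subst measurable_cong) auto
qed

text \<open>Both parts reduce to countably many evaluations. The value of the minorant comes first,
  because the criterion for the slope compares \<open>Y\<close> with a line through that random
  value.\<close>

lemma
  fixes Y :: "'a \<Rightarrow> real \<Rightarrow> real"
  assumes t: "l < t" "t < u"
    and meas: "\<And>s. s \<in> {l..u} \<Longrightarrow> (\<lambda>\<omega>. Y \<omega> s) \<in> borel_measurable M"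
    and bdd: "\<And>\<omega>. \<omega> \<in> space M \<Longrightarrow> bdd_below (Y \<omega> ` {l..u})"
    and rc: "\<And>\<omega> s. \<omega> \<in> space M \<Longrightarrow> l \<le> s \<Longrightarrow> s < u \<Longrightarrow> (Y \<omega> \<longlongrightarrow> Y \<omega> s) (at_right s)"
  shows borel_measurable_gcm: "(\<lambda>\<omega>. gcm {l..u} (Y \<omega>) t) \<in> borel_measurable M"
    and borel_measurable_right_deriv_gcm:
      "(\<lambda>\<omega>. right_deriv (gcm {l..u} (Y \<omega>)) t) \<in> borel_measurable M"
proof -
  have I: "convex {l..u}" "bounded {l..u}" "t \<in> interior {l..u}" using t by auto
  show gcm_meas: "(\<lambda>\<omega>. gcm {l..u} (Y \<omega>) t) \<in> borel_measurable M"
  proof (subst borel_measurable_iff_greater, intro allI)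
    fix b
    have "Measurable.pred M (\<lambda>\<omega>. \<forall>s\<in>{l..u}. 0 \<le> Y \<omega> s - (r + q * s))" for q r
      using meas by (intro pred_right_continuous_nonneg) (auto intro!: tendsto_intros rc)
    then have "Measurable.pred M (\<lambda>\<omega>. \<exists>q\<in>\<rat>. \<exists>r\<in>\<rat>. b < r + q * t \<and>
        (\<forall>s\<in>{l..u}. 0 \<le> Y \<omega> s - (r + q * s)))"
      by (intro measurable_pred_countable(2) countable_rat pred_intros_logic) auto
    moreover have "{\<omega> \<in> space M. b < gcm {l..u} (Y \<omega>) t} =
        {\<omega> \<in> space M. \<exists>q\<in>\<rat>. \<exists>r\<in>\<rat>. b < r + q * t \<and> (\<forall>s\<in>{l..u}. 0 \<le> Y \<omega> s - (r + q * s))}"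
      using gcm_greater_iff[OF I bdd] by blast
    ultimately show "{\<omega> \<in> space M. b < gcm {l..u} (Y \<omega>) t} \<in> sets M"
      by (simp add: pred_def)
  qed
  show "(\<lambda>\<omega>. right_deriv (gcm {l..u} (Y \<omega>)) t) \<in> borel_measurable M"
  proof (subst borel_measurable_iff_less, intro allI)
    fix a
    let ?Z = "\<lambda>\<omega> s. Y \<omega> s - (gcm {l..u} (Y \<omega>) t + a * (s - t))"
    have pred: "Measurable.pred M (\<lambda>\<omega>. \<forall>s\<in>{t..u}. 0 \<le> ?Z \<omega> s)"
      using meas gcm_meas t
      by (intro pred_right_continuous_nonneg) (auto intro!: tendsto_intros rc)
    have "right_deriv (gcm {l..u} (Y \<omega>)) t < a \<longleftrightarrow> \<not> (\<forall>s\<in>{t..u}. 0 \<le> ?Z \<omega> s)"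
      if \<omega>: "\<omega> \<in> space M" for \<omega>
    proof -
      \<comment> \<open>The inequality at \<open>t\<close> itself is automatic, so the half-open
        range of the criterion may be closed.\<close>
      have "0 \<le> ?Z \<omega> t" using gcm_le[OF I(1) bdd[OF \<omega>], of t] t by simp
      then have "(\<forall>s\<in>{t..u}. 0 \<le> ?Z \<omega> s) \<longleftrightarrow> (\<forall>s\<in>{l..u}. t < s \<longrightarrow> 0 \<le> ?Z \<omega> s)"
        using t by (metis (no_types, lifting) atLeastAtMost_iff less_eq_real_def order_trans)
      then show ?thesis
        using right_deriv_gcm_less_iff[OF I(1,3) bdd[OF \<omega>], of a] by force
    qed
    then have "{\<omega> \<in> space M. right_deriv (gcm {l..u} (Y \<omega>)) t < a} =
        {\<omega> \<in> space M. \<not> (\<forall>s\<in>{t..u}. 0 \<le> ?Z \<omega> s)}" by blast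
    then show "{\<omega> \<in> space M. right_deriv (gcm {l..u} (Y \<omega>)) t < a} \<in> sets M"
      using sets.sets_Collect_neg[OF pred[unfolded pred_def]] by simp
  qed
qed

section \<open>Weak convergence for the ball algebra\<close>

lemma space_ball_algebra: "space (ball_algebra m) = mspace m"
  unfolding ball_algebra_def by (rule space_measure_of) auto

lemma mdist_measurable_ball_algebra:
  assumes "u \<in> mspace m"
  shows "mdist m u \<in> borel_measurable (ball_algebra m)"
proof -
  have sub: "{mball_of m x r | x r. x \<in> mspace m} \<subseteq> Pow (mspace m)" by auto
  have "{z \<in> space (ball_algebra m). mdist m u z < r} \<in> sets (ball_algebra m)" for r
  proof -
    have "{z \<in> space (ball_algebra m). mdist m u z < r} = mball_of m u r"
      using assms by (auto simp: space_ball_algebra)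
    then show ?thesis
      using assms unfolding ball_algebra_def sets_measure_of[OF sub] by auto
  qed
  then show ?thesis by (subst borel_measurable_iff_less) auto
qed

text \<open>
  Portmanteau for open sets, allowing the events to depend on \<open>n\<close>.  Every outcome in \<open>F\<close> lies in one
  of countably many balls on which eventually \<open>E n\<close> holds, and the indicator of their union is an
  increasing limit of admissible test functions.
\<close>

lemma converges_in_law_liminf:
  fixes X :: "nat \<Rightarrow> 'a \<Rightarrow> 'b" and Y :: "'c \<Rightarrow> 'b"
  assumes conv: "converges_in_law m (ball_algebra m) M X N Y"
    and prob: "\<And>n. prob_space (M n)" "prob_space N"
    and E: "\<forall>\<^sub>F n in sequentially. E n \<in> sets (M n)" and F: "F \<in> sets N"
    and C: "countable C" "C \<subseteq> mspace m" "AE \<omega> in N. \<forall>e>0. \<exists>u\<in>C. mdist m u (Y \<omega>) < e"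
    and near: "AE \<omega> in N. \<omega> \<in> F \<longrightarrow> (\<exists>r>0. \<forall>\<^sub>F n in sequentially.
      \<forall>\<omega>'\<in>space (M n). mdist m (Y \<omega>) (X n \<omega>') < r \<longrightarrow> \<omega>' \<in> E n)"
    and e: "0 < e"
  shows "\<forall>\<^sub>F n in sequentially. measure N F - e < measure (M n) (E n)"
proof -
  interpret N: prob_space N by fact
  \<comment> \<open>The centre is a parameter, so that the random centre \<open>Y \<omega>\<close>
    can be exchanged for a fixed one.\<close>
  define good where "good u r \<longleftrightarrow> (\<forall>\<^sub>F n in sequentially.
      \<forall>\<omega>'\<in>space (M n). mdist m u (X n \<omega>') < r \<longrightarrow> \<omega>' \<in> E n)" for u and r :: real
  define K where "K = {(u, q). u \<in> C \<and> q \<in> \<rat> \<and> good u q}"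
  have X: "X n \<in> measurable (M n) (ball_algebra m)" for n
    using conv by (simp add: converges_in_law_def)
  have Y: "Y \<in> measurable N (ball_algebra m)"
    using conv by (simp add: converges_in_law_def)
  have X_space: "X n \<omega> \<in> mspace m" if "\<omega> \<in> space (M n)" for n \<omega>
    using measurable_space[OF X that] by (simp add: space_ball_algebra)
  have Y_space: "Y \<omega> \<in> mspace m" if "\<omega> \<in> space N" for \<omega>
    using measurable_space[OF Y that] by (simp add: space_ball_algebra)
  interpret m: Metric_space "mspace m" "mdist m" by (rule Metric_space_mspace_mdist)

  have cover: "AE \<omega> in N. \<omega> \<in> F \<longrightarrow> (\<exists>(u, q)\<in>K. mdist m u (Y \<omega>) < q)"
    using C(3) near AE_space
  proof eventually_elim
    case (elim \<omega>)
    show ?case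
    proof
      assume "\<omega> \<in> F"
      then obtain r where r: "r > 0" "good (Y \<omega>) r" using elim(2) by (auto simp: good_def)
      \<comment> \<open>With \<open>u\<close> within \<open>r / 2\<close> and \<open>q\<close> below
        \<open>r / 2\<close>, the \<open>q\<close>-ball about \<open>u\<close> contains
        \<open>Y \<omega>\<close> and lies in the \<open>r\<close>-ball about it.\<close>
      obtain u where u: "u \<in> C" "mdist m u (Y \<omega>) < r / 2" using elim(1) r by (meson half_gt_zero)
      obtain q where q: "q \<in> \<rat>" "mdist m u (Y \<omega>) < q" "q < r / 2"
        using Rats_dense_in_real[OF u(2)] by blast
      have "mdist m (Y \<omega>) (X n \<omega>') < r"
        if "\<omega>' \<in> space (M n)" "mdist m u (X n \<omega>') < q" for n \<omega>'
        using m.triangle[of "Y \<omega>" u "X n \<omega>'"] m.commute[of u "Y \<omega>"] u C(2)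
          Y_space[OF elim(3)] X_space[OF that(1)] that(2) q by auto
      then have "good u q"
        using r(2) unfolding good_def by (auto elim!: eventually_mono)
      then show "\<exists>(u, q)\<in>K. mdist m u (Y \<omega>) < q"
        using u q by (auto simp: K_def)
    qed
  qed

  show ?thesis
  \<comment> \<open>Only a nonempty \<open>K\<close> can be enumerated by \<open>range k\<close>; if
    it is empty, the cover shows \<open>F\<close> to be null.\<close>
  proof (cases "K = {}")
    case True
    then have "AE \<omega> in N. \<omega> \<notin> F" using cover by simp
    then have "measure N F = 0"
      using F by (simp add: N.prob_eq_0)
    then have "measure N F - e < measure (M n) (E n)" for n
      using e measure_nonneg[of "M n" "E n"] by linarith
    then show ?thesis by simp
  next
    case False
    have "K \<subseteq> C \<times> \<rat>" by (auto simp: K_def)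
    then have "countable K"
      using C(1) countable_rat by (meson countable_SIGMA countable_subset)
    then obtain k :: "nat \<Rightarrow> 'b \<times> real" where k: "range k = K"
      using False by (metis range_from_nat_into)
    define c r where "c i = fst (k i)" and "r i = snd (k i)" for i
    have cr: "c i \<in> mspace m" "good (c i) (r i)" for i
      using k C(2) rangeI[of k i] by (auto simp: K_def c_def r_def)
    \<comment> \<open>A sum of tents over the first \<open>j\<close> balls, steepened by the factor
      \<open>j\<close> and truncated at 1. It vanishes off these balls and increases to the
      indicator of the union of all of them.\<close>
    define \<phi> where
      "\<phi> j z = min 1 (\<Sum>i<j. real j * max 0 (r i - mdist m (c i) z))" for j z
    have \<phi>_bounds: "0 \<le> \<phi> j z" "\<phi> j z \<le> 1" for j z
      by (auto simp: \<phi>_def intro!: sum_nonneg)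
    have \<phi>_meas: "\<phi> j \<in> borel_measurable (ball_algebra m)" for j
      unfolding \<phi>_def using mdist_measurable_ball_algebra[OF cr(1)] by measurable
    have \<phi>_cont: "continuous_map (mtopology_of m) euclidean (\<phi> j)" for j
      unfolding \<phi>_def using cr(1) by (intro continuous_intros) auto
    have lim: "(\<lambda>n. \<integral>\<omega>. \<phi> j (X n \<omega>) \<partial>M n) \<longlonglongrightarrow> (\<integral>\<omega>. \<phi> j (Y \<omega>) \<partial>N)" for j
      using conv \<phi>_meas \<phi>_cont \<phi>_bounds unfolding converges_in_law_def
      by (metis abs_of_nonneg)

    \<comment> \<open>The factor \<open>indicator F\<close> restricts attention to outcomes that the
      balls cover almost surely, so the limit is \<open>measure N F\<close>.\<close>
    have "(\<lambda>j. \<integral>\<omega>. \<phi> j (Y \<omega>) * indicator F \<omega> \<partial>N) \<longlonglongrightarrow> (\<integral>\<omega>. indicator F \<omega> \<partial>N)"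
    proof (rule integral_dominated_convergence[where w = "\<lambda>_. 1"])
      show "(\<lambda>\<omega>. \<phi> j (Y \<omega>) * indicator F \<omega>) \<in> borel_measurable N" for j
        using measurable_compose[OF Y \<phi>_meas] F by measurable
      show "AE \<omega> in N. norm (\<phi> j (Y \<omega>) * indicator F \<omega>) \<le> 1" for j
        using \<phi>_bounds by (auto simp: indicator_def)
      show "AE \<omega> in N. (\<lambda>j. \<phi> j (Y \<omega>) * indicator F \<omega>) \<longlonglongrightarrow> indicator F \<omega>"
        using cover
      proof eventually_elim
        case (elim \<omega>)
        show ?case
        proof (cases "\<omega> \<in> F")
          case True
          with elim obtain u q where uq: "(u, q) \<in> K" "mdist m u (Y \<omega>) < q" by auto
          then obtain i where i: "c i = u" "r i = q"
            using k by (metis c_def fst_conv imageE r_def snd_conv)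
          \<comment> \<open>From \<open>j0\<close> on the slope lifts the tent at
            \<open>Y \<omega>\<close> to at least 1; \<open>Suc i\<close> ensures that this tent is
            in the sum.\<close>
          obtain j0 where j0: "1 / (q - mdist m u (Y \<omega>)) < real j0"
            using reals_Archimedean2 by blast
          have "\<phi> j (Y \<omega>) = 1" if j: "j \<ge> max j0 (Suc i)" for j
          proof -
            have "1 / (q - mdist m u (Y \<omega>)) \<le> real j" using j j0 by linarith
            then have "1 \<le> real j * (q - mdist m u (Y \<omega>))"
              using uq(2) by (simp add: field_simps)
            also have "\<dots> = real j * max 0 (r i - mdist m (c i) (Y \<omega>))"
              using uq(2) i by simp
            also have "\<dots> \<le> (\<Sum>i<j. real j * max 0 (r i - mdist m (c i) (Y \<omega>)))"
              using j by (intro member_le_sum) auto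
            finally show ?thesis by (simp add: \<phi>_def)
          qed
          then have "eventually (\<lambda>j. \<phi> j (Y \<omega>) = 1) sequentially"
            unfolding eventually_sequentially by blast
          then show ?thesis using True by (auto intro: tendsto_eventually)
        qed simp
      qed
    qed (use F in auto)
    then have "(\<lambda>j. \<integral>\<omega>. \<phi> j (Y \<omega>) * indicator F \<omega> \<partial>N) \<longlonglongrightarrow> measure N F"
      using F by simp
    then have "eventually (\<lambda>j. measure N F - e < (\<integral>\<omega>. \<phi> j (Y \<omega>) * indicator F \<omega> \<partial>N)) sequentially"
      using e by (intro order_tendstoD) auto
    then obtain j where j: "measure N F - e < (\<integral>\<omega>. \<phi> j (Y \<omega>) * indicator F \<omega> \<partial>N)"
      using eventually_happens'[OF sequentially_bot] by blast
    also have "\<dots> \<le> (\<integral>\<omega>. \<phi> j (Y \<omega>) \<partial>N)"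
    proof (rule integral_mono)
      have meas: "(\<lambda>\<omega>. \<phi> j (Y \<omega>)) \<in> borel_measurable N"
        using measurable_compose[OF Y \<phi>_meas] .
      show "integrable N (\<lambda>\<omega>. \<phi> j (Y \<omega>))"
        using \<phi>_bounds by (intro N.integrable_const_bound[where B = 1] meas) auto
      show "integrable N (\<lambda>\<omega>. \<phi> j (Y \<omega>) * indicator F \<omega>)"
        using \<phi>_bounds F meas
        by (intro N.integrable_const_bound[where B = 1]) (auto simp: indicator_def)
    qed (use \<phi>_bounds in \<open>auto simp: indicator_def\<close>)
    finally have "\<forall>\<^sub>F n in sequentially. measure N F - e < (\<integral>\<omega>. \<phi> j (X n \<omega>) \<partial>M n)"
      by (rule order_tendstoD(1)[OF lim])
    \<comment> \<open>Fixing \<open>j\<close> first leaves finitely many balls, so one threshold for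
      \<open>n\<close> serves all of them.\<close>
    moreover have "\<forall>\<^sub>F n in sequentially. \<forall>i\<in>{..<j}.
        \<forall>\<omega>'\<in>space (M n). mdist m (c i) (X n \<omega>') < r i \<longrightarrow> \<omega>' \<in> E n"
      using cr(2) by (intro eventually_ball_finite) (auto simp: good_def)
    ultimately show ?thesis
      using E
    proof eventually_elim
      case (elim n)
      interpret Mn: prob_space "M n" by fact
      have "(\<integral>\<omega>. \<phi> j (X n \<omega>) \<partial>M n) \<le> (\<integral>\<omega>. indicator (E n) \<omega> \<partial>M n)"
      proof (rule integral_mono)
        show "integrable (M n) (\<lambda>\<omega>. \<phi> j (X n \<omega>))"
          using \<phi>_bounds measurable_compose[OF X \<phi>_meas]
          by (intro Mn.integrable_const_bound[where B = 1]) auto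
        show "integrable (M n) (indicator (E n) :: 'a \<Rightarrow> real)"
          using elim(3) by (intro Mn.integrable_const_bound[where B = 1]) auto
        fix \<omega> assume \<omega>: "\<omega> \<in> space (M n)"
        show "\<phi> j (X n \<omega>) \<le> indicator (E n) \<omega>"
        proof (cases "\<omega> \<in> E n")
          case False
          then have "\<forall>i<j. r i \<le> mdist m (c i) (X n \<omega>)"
            using elim(2) \<omega> by force
          then have "\<phi> j (X n \<omega>) = 0" by (simp add: \<phi>_def)
          then show ?thesis by simp
        qed (use \<phi>_bounds in simp)
      qed
      also have "\<dots> = measure (M n) (E n)" using elim(3) by simp
      finally show ?case using elim(1) by simp
    qed
  qed
qed

lemma (in prob_space)
  assumes f[measurable]: "f \<in> borel_measurable M"
  shows prob_le_eq_1_minus_prob_greater: "\<P>(\<omega> in M. f \<omega> \<le> a) = 1 - \<P>(\<omega> in M. a < (f \<omega> :: real))"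
    and cdf_distr: "cdf (distr M borel f) a = \<P>(\<omega> in M. f \<omega> \<le> a)"
    and prob_less_le_prob_le: "\<P>(\<omega> in M. f \<omega> < a) \<le> \<P>(\<omega> in M. f \<omega> \<le> a)"
proof -
  have "\<P>(\<omega> in M. a < f \<omega>) = prob (space M - {\<omega> \<in> space M. f \<omega> \<le> a})"
    by (rule arg_cong[where f = prob]) auto
  then show "\<P>(\<omega> in M. f \<omega> \<le> a) = 1 - \<P>(\<omega> in M. a < f \<omega>)"
    by (simp add: prob_compl)
  show "cdf (distr M borel f) a = \<P>(\<omega> in M. f \<omega> \<le> a)"
    unfolding cdf_def by (subst measure_distr) (auto intro!: arg_cong[where f = prob])
  show "\<P>(\<omega> in M. f \<omega> < a) \<le> \<P>(\<omega> in M. f \<omega> \<le> a)"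
    by (intro finite_measure_mono) auto
qed

text \<open>Lower bounds on left half-lines bound the distribution functions from below; those on
  right half-lines bound them from above by complementation.\<close>

lemma weak_conv_m_distrI:
  fixes Z :: "nat \<Rightarrow> 'a \<Rightarrow> real" and Z' :: "'b \<Rightarrow> real"
  assumes prob: "\<And>n. prob_space (M n)" "prob_space N"
    and Z: "\<forall>\<^sub>F n in sequentially. Z n \<in> borel_measurable (M n)"
    and Z': "Z' \<in> borel_measurable N"
    and less: "\<And>a e. 0 < e \<Longrightarrow> \<forall>\<^sub>F n in sequentially.
      measure N {\<omega> \<in> space N. Z' \<omega> < a} - e < measure (M n) {\<omega> \<in> space (M n). Z n \<omega> < a}"
    and greater: "\<And>a e. 0 < e \<Longrightarrow> \<forall>\<^sub>F n in sequentially.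
      measure N {\<omega> \<in> space N. a < Z' \<omega>} - e < measure (M n) {\<omega> \<in> space (M n). a < Z n \<omega>}"
  shows "weak_conv_m (\<lambda>n. distr (M n) borel (Z n)) (distr N borel Z')"
  unfolding weak_conv_m_def weak_conv_def
proof (intro allI impI)
  fix a assume a: "isCont (cdf (distr N borel Z')) a"
  interpret N: prob_space N by fact
  interpret D: real_distribution "distr N borel Z'" by (rule N.real_distribution_distr[OF Z'])
  \<comment> \<open>Continuity of the distribution function excludes an atom at \<open>a\<close>, so
    the strict and the weak inequality have equal probability.\<close>
  have "measure (distr N borel Z') {a} = 0" using a by (simp add: D.isCont_cdf)
  then have 0: "measure N {\<omega> \<in> space N. Z' \<omega> = a} = 0"
    using measure_distr[OF Z', of "{a}"] by (simp add: vimage_def Int_def conj_commute)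
  have "measure N {\<omega> \<in> space N. Z' \<omega> \<le> a} =
      measure N ({\<omega> \<in> space N. Z' \<omega> < a} \<union> {\<omega> \<in> space N. Z' \<omega> = a})"
    by (rule arg_cong[where f = "measure N"]) auto
  also have "\<dots> = measure N {\<omega> \<in> space N. Z' \<omega> < a}"
    using Z'[measurable] 0 by (subst N.finite_measure_Union) auto
  finally have eq: "measure N {\<omega> \<in> space N. Z' \<omega> \<le> a} = measure N {\<omega> \<in> space N. Z' \<omega> < a}" .
  show "(\<lambda>n. cdf (distr (M n) borel (Z n)) a) \<longlonglongrightarrow> cdf (distr N borel Z') a"
  proof (rule order_tendstoI)
    fix b assume "b < cdf (distr N borel Z') a"
    then have "0 < cdf (distr N borel Z') a - b" by simp
    from less[OF this, of a] Z show "\<forall>\<^sub>F n in sequentially. b < cdf (distr (M n) borel (Z n)) a"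
    proof eventually_elim
      case (elim n)
      then show ?case
        using prob_space.cdf_distr[OF prob(1) elim(2)] N.cdf_distr[OF Z']
          prob_space.prob_less_le_prob_le[OF prob(1) elim(2), of a] eq by simp
    qed
  next
    fix b assume "cdf (distr N borel Z') a < b"
    then have "0 < b - cdf (distr N borel Z') a" by simp
    from greater[OF this, of a] Z
    show "\<forall>\<^sub>F n in sequentially. cdf (distr (M n) borel (Z n)) a < b"
    proof eventually_elim
      case (elim n)
      then show ?case
        using prob_space.cdf_distr[OF prob(1) elim(2)] N.cdf_distr[OF Z']
          prob_space.prob_le_eq_1_minus_prob_greater[OF prob(1) elim(2), of a]
          N.prob_le_eq_1_minus_prob_greater[OF Z', of a] by simp
    qed
  qed
qed

section \<open>Right-continuous functions and rescaling\<close>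

lemma cadlag_tendsto_at_right:
  assumes "x \<in> cadlag_on UNIV"
  shows "(x \<longlongrightarrow> x t) (at_right t)"
  using assms by (auto simp: cadlag_on_def)

lemma cadlag_diff_continuous:
  fixes h :: "real \<Rightarrow> real"
  assumes x: "x \<in> cadlag_on UNIV" and h: "continuous_on UNIV h"
  shows "(\<lambda>s. x s - h s) \<in> cadlag_on UNIV"
proof -
  have h': "(h \<longlongrightarrow> h t) (at t within S)" for t S
    using h by (metis UNIV_I continuous_on_def subset_UNIV tendsto_within_subset)
  show ?thesis
    unfolding cadlag_on_def
  proof (intro CollectI ballI conjI)
    fix t
    show "((\<lambda>s. x s - h s) \<longlongrightarrow> x t - h t) (at t within UNIV \<inter> {t<..})"
      using x h' by (auto simp: cadlag_on_def intro!: tendsto_diff)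
    obtain l where "(x \<longlongrightarrow> l) (at t within UNIV \<inter> {..<t})"
      using x unfolding cadlag_on_def by blast
    then show "\<exists>l. ((\<lambda>s. x s - h s) \<longlongrightarrow> l) (at t within UNIV \<inter> {..<t})"
      using tendsto_diff[OF _ h'] by blast
  qed
qed

text \<open>Translations are isometries, which lets a dense set found for \<open>y_lim\<close> be
  moved to one for \<open>v_lim\<close>.\<close>

lemma rho_translate: "rho (\<lambda>s. x s - h s) (\<lambda>s. z s - h s) = rho x z"
  by (simp add: rho_def rho_k_def)

text \<open>A single nonnegative term of the series is at most the distance, and
  \<open>u / (1 + u)\<close> is increasing for nonnegative \<open>u\<close>.\<close>

lemma D_metric_uniformly_close:
  assumes "0 < \<delta>"
  shows "\<exists>r>0. \<forall>x\<in>cadlag_on UNIV. \<forall>z\<in>cadlag_on UNIV. mdist D_metric x z < r \<longrightarrow>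
    (\<forall>s\<in>{- c..c}. \<bar>x s - z s\<bar> < \<delta>)"
proof -
  obtain k where k: "c \<le> real k" using real_arch_simple by blast
  \<comment> \<open>The term with index \<open>k\<close> carries the weight and the window of
    \<open>Suc k\<close>, and that window contains \<open>{- c..c}\<close>.\<close>
  define r where "r = (1 / 2) ^ Suc k * (\<delta> / (1 + \<delta>))"
  have "\<bar>x s - z s\<bar> < \<delta>"
    if D: "x \<in> cadlag_on UNIV" "z \<in> cadlag_on UNIV" and less: "mdist D_metric x z < r"
      and s: "s \<in> {- c..c}" for x z s
  proof -
    let ?t = "\<lambda>k. (1 / 2) ^ Suc k * (rho_k (Suc k) x z / (1 + rho_k (Suc k) x z)) :: real"
    have nonneg: "0 \<le> rho_k (Suc k) x z" for k by (rule rho_k_nonneg[OF D])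
    have "?t k = sum ?t {k}" by simp
    also have "\<dots> \<le> suminf ?t"
      using nonneg by (intro sum_le_suminf summable_rho D) auto
    also have "\<dots> < (1 / 2) ^ Suc k * (\<delta> / (1 + \<delta>))"
      using less D by (simp only: mdist_D_metric rho_def r_def)
    finally have "rho_k (Suc k) x z / (1 + rho_k (Suc k) x z) < \<delta> / (1 + \<delta>)"
      by (rule mult_left_less_imp_less) simp
    then have "rho_k (Suc k) x z < \<delta>"
      using nonneg[of k] assms by (simp add: divide_simps algebra_simps)
    moreover have "\<bar>x s - z s\<bar> \<le> rho_k (Suc k) x z"
      using s k by (intro rho_k_upper D) auto
    ultimately show ?thesis by simp
  qed
  moreover have "0 < r" using assms by (simp add: r_def)
  ultimately show ?thesis by blast
qed

lemma separable_subset_countable_dense: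
  assumes "separable_space (subtopology (mtopology_of m) S)" "S \<subseteq> mspace m"
  obtains C where "countable C" "C \<subseteq> S" "\<And>z e. z \<in> S \<Longrightarrow> 0 < e \<Longrightarrow> \<exists>u\<in>C. mdist m u z < e"
proof -
  interpret m: Metric_space "mspace m" "mdist m" by (rule Metric_space_mspace_mdist)
  let ?T = "subtopology (mtopology_of m) S"
  have top: "topspace ?T = S" using assms(2) by auto
  obtain C where C: "countable C" "C \<subseteq> S" "?T closure_of C = S"
    using assms(1) unfolding separable_space_def top by blast
  have "\<exists>u\<in>C. mdist m u z < e" if z: "z \<in> S" and e: "0 < e" for z e
  proof -
    have "openin ?T (mball_of m z e \<inter> S)"
      unfolding mtopology_of_def mball_of_def
      by (intro openin_subtopology_Int m.openin_mball)
    moreover have "z \<in> mball_of m z e \<inter> S" using z e assms(2) by auto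
    moreover have "z \<in> ?T closure_of C" using C z by simp
    ultimately obtain u where "u \<in> C" "u \<in> mball_of m z e"
      unfolding in_closure_of by blast
    then show ?thesis by (auto simp: m.commute)
  qed
  then show thesis using that C by blast
qed

text \<open>The interior is named instead of \<open>J\<close> because convex drifts are continuous
  there.\<close>

lemma eventually_rescaled_in_interior:
  fixes J :: "real set"
  assumes "t\<^sub>0 \<in> interior J" "\<And>n. 0 < d n" "d \<longlonglongrightarrow> 0"
  shows "\<forall>\<^sub>F n in sequentially. \<forall>s\<in>{- c..c}. t\<^sub>0 + s * d n \<in> interior J"
proof -
  obtain e where e: "0 < e" "ball t\<^sub>0 e \<subseteq> interior J"
    using openE[OF open_interior assms(1)] by blast
  have "(\<lambda>n. \<bar>c\<bar> * d n) \<longlonglongrightarrow> \<bar>c\<bar> * 0" by (intro tendsto_intros assms(3))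
  then have "\<forall>\<^sub>F n in sequentially. \<bar>c\<bar> * d n < e"
    using e(1) by (intro order_tendstoD) auto
  then show ?thesis
  proof eventually_elim
    case (elim n)
    have "t\<^sub>0 + s * d n \<in> ball t\<^sub>0 e" if "s \<in> {- c..c}" for s
    proof -
      have "\<bar>s * d n\<bar> \<le> \<bar>c\<bar> * d n"
        using that assms(2)[of n] by (auto simp: abs_mult intro!: mult_right_mono)
      then show ?thesis using elim by (simp add: dist_real_def)
    qed
    then show ?case using e(2) by blast
  qed
qed

lemma const_extension_eq:
  assumes "0 < \<delta>" "t\<^sub>0 + s * \<delta> \<in> J"
  shows "const_extension (rescaled_interval J t\<^sub>0 \<delta>) h s = h s"
proof -
  have "s \<in> rescaled_interval J t\<^sub>0 \<delta>"
    unfolding rescaled_interval_def by (rule image_eqI[OF _ assms(2)]) (use assms(1) in simp)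
  then show ?thesis by (simp add: const_extension_def)
qed

lemma isCont_rescaled_drift:
  assumes f: "convex_on J f" and s: "t\<^sub>0 + s * \<delta> \<in> interior J"
  shows "isCont (rescaled_drift p \<delta> t\<^sub>0 f) s"
proof -
  have "convex_on (interior J) f"
    using f convex_on_imp_convex[OF f] by (meson convex_on_subset convex_interior interior_subset)
  then have "isCont f (t\<^sub>0 + s * \<delta>)"
    using s convex_on_continuous[of "interior J" f] by (simp add: continuous_on_eq_continuous_at)
  then have "isCont (\<lambda>s. f (t\<^sub>0 + s * \<delta>)) s"
    by (rule isCont_o2[where f = "\<lambda>s. t\<^sub>0 + s * \<delta>", rotated]) (intro continuous_intros)
  then show ?thesis
    unfolding rescaled_drift_def[abs_def] by (intro continuous_intros)
qed

text \<open>For small \<open>n\<close> the window \<open>{-c..c}\<close> may leave the rescaled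
  interval, where the values of \<open>y n\<close> are unconstrained. Measurability of the slope is
  therefore asserted for all large \<open>n\<close>.\<close>

theorem proposition2:
  fixes J :: "real set" and t\<^sub>0 p A :: real and d :: "nat \<Rightarrow> real"
    and M :: "nat \<Rightarrow> 'a measure" and N :: "'b measure"
    and x v :: "nat \<Rightarrow> 'a \<Rightarrow> real \<Rightarrow> real" and x\<^sub>b :: "nat \<Rightarrow> real \<Rightarrow> real"
    and v_lim :: "'b \<Rightarrow> real \<Rightarrow> real"
    and g :: "nat \<Rightarrow> real \<Rightarrow> real" and y :: "nat \<Rightarrow> 'a \<Rightarrow> real \<Rightarrow> real"
    and y_lim :: "'b \<Rightarrow> real \<Rightarrow> real"
  assumes J: "is_interval J" and t0: "t\<^sub>0 \<in> interior J"
    and p: "1 < p"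
    and d: "\<And>n. 0 < d n" "decseq d" "d \<longlonglongrightarrow> 0"
    and prob: "\<And>n. prob_space (M n)" "prob_space N"
    and x_process: "\<And>n. cadlag_process (M n) J (x n)"
    and v_process: "\<And>n. cadlag_process (M n) J (v n)"
    and x_decomp: "\<And>n \<omega> t. \<omega> \<in> space (M n) \<Longrightarrow> t \<in> J \<Longrightarrow> x n \<omega> t = x\<^sub>b n t + v n \<omega> t"
    and x_bounded_below: "\<And>n. AE \<omega> in M n. bdd_below (x n \<omega> ` J)"
    and g_def: "\<And>n s. g n s = rescaled_drift p (d n) t\<^sub>0 (x\<^sub>b n) s"
    and y_def: "\<And>n \<omega> s. y n \<omega> s = g n s + rescaled_noise p (d n) t\<^sub>0 (v n \<omega>) s"
    and v_lim_process: "cadlag_process N UNIV v_lim"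
    and v_lim_nonzero: "\<not> (AE \<omega> in N. \<forall>s. v_lim \<omega> s = 0)"
    and v_conv: "converges_in_law D_metric (ball_algebra D_metric)
          M (\<lambda>n \<omega>. const_extension (rescaled_interval J t\<^sub>0 (d n))
                       (rescaled_noise p (d n) t\<^sub>0 (v n \<omega>)))
          N v_lim"
    and x\<^sub>b_convex: "\<And>n. convex_on J (x\<^sub>b n)"
    and A: "0 < A"
    and g_conv: "\<And>c. 0 < c \<Longrightarrow> (\<lambda>n. SUP s\<in>{-c..c}. \<bar>g n s - A * \<bar>s\<bar> powr p\<bar>) \<longlonglongrightarrow> 0"
    and y_lim_def: "\<And>\<omega> s. y_lim \<omega> s = A * \<bar>s\<bar> powr p + v_lim \<omega> s"
    and y_lim_regular: "\<exists>S \<subseteq> mspace D_metric.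
          separable_space (subtopology (mtopology_of D_metric) S) \<and>
          (\<forall>z\<in>S. completely_regular_point D_metric (ball_algebra D_metric) z) \<and>
          (AE \<omega> in N. y_lim \<omega> \<in> S)"
    and y_lim_no_kink: "\<And>a c \<epsilon>. 0 < c \<Longrightarrow> 0 < \<epsilon> \<Longrightarrow>
          \<P>(\<omega> in N. \<forall>s\<in>{-c..c}. y_lim \<omega> s - y_lim \<omega> 0 - a * s \<ge> \<epsilon> * \<bar>s\<bar>) = 0"
    and c: "0 < (c::real)"
  shows "(\<lambda>\<omega>. right_deriv (gcm {-c..c} (y_lim \<omega>)) 0) \<in> borel_measurable N \<and>
         (\<forall>\<^sub>F n in sequentially.
            (\<lambda>\<omega>. right_deriv (gcm {-c..c} (y n \<omega>)) 0) \<in> borel_measurable (M n)) \<and>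
         weak_conv_m
           (\<lambda>n. distr (M n) borel (\<lambda>\<omega>. right_deriv (gcm {-c..c} (y n \<omega>)) 0))
           (distr N borel (\<lambda>\<omega>. right_deriv (gcm {-c..c} (y_lim \<omega>)) 0))"
proof -

  \<comment> \<open>Notation and regularity of the paths\<close>
  interpret N: prob_space N by (rule prob)
  define I where "I = {- c..c}"
  define h where "h s = A * \<bar>s\<bar> powr p" for s :: real
  define X where "X n \<omega> = const_extension (rescaled_interval J t\<^sub>0 (d n))
      (rescaled_noise p (d n) t\<^sub>0 (v n \<omega>))" for n \<omega>
  define R where "R w = right_deriv (gcm I w) 0" for w
  have I: "convex I" "0 \<in> interior I" using c by (auto simp: I_def)
  have h_cont: "continuous_on UNIV h"
    unfolding h_def[abs_def] using p
    by (intro continuous_on_mult continuous_on_const continuous_on_powr' continuous_on_rabs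
        continuous_on_id) auto

  have X_cadlag: "X n \<omega> \<in> cadlag_on UNIV" if "\<omega> \<in> space (M n)" for n \<omega>
    using v_conv measurable_space[OF _ that, of "X n" "ball_algebra D_metric"]
    by (simp add: converges_in_law_def space_ball_algebra X_def[abs_def])
  have v_lim_cadlag: "v_lim \<omega> \<in> cadlag_on UNIV" if "\<omega> \<in> space N" for \<omega>
    using v_lim_process that by (simp add: cadlag_process_def)
  \<comment> \<open>Used with \<open>h\<close> as the continuous part for the limit and with
    \<open>g n\<close> for the sequence.\<close>
  have cadlag_plus: "bdd_below ((\<lambda>s. k s + x s) ` I)"
      "\<And>s. s \<in> I \<Longrightarrow> ((\<lambda>s. k s + x s) \<longlongrightarrow> k s + x s) (at_right s)"
    if x: "x \<in> cadlag_on UNIV" and k: "\<And>s. s \<in> I \<Longrightarrow> isCont k s" for k x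
  proof -
    have "continuous_on I k" using k by (simp add: continuous_at_imp_continuous_on)
    then have "bounded (k ` I)"
      by (intro compact_imp_bounded compact_continuous_image) (simp_all add: I_def)
    then have "bounded ((\<lambda>s. k s + x s) ` I)"
      using cadlag_locally_bounded[OF x, of "- c" c] by (intro bounded_plus_comp) (simp_all add: I_def)
    then show "bdd_below ((\<lambda>s. k s + x s) ` I)" by (rule bounded_imp_bdd_below)
    show "((\<lambda>s. k s + x s) \<longlongrightarrow> k s + x s) (at_right s)" if "s \<in> I" for s
    proof (rule tendsto_add[OF _ cadlag_tendsto_at_right[OF x]])
      show "(k \<longlongrightarrow> k s) (at_right s)"
        using k[OF that] by (simp add: isCont_def filterlim_at_split)
    qed
  qed

  \<comment> \<open>The limit process and measurability of its slope\<close>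
  have h_isCont: "isCont h s" for s
    using h_cont by (simp add: continuous_on_eq_continuous_at)
  have y_lim_eq: "y_lim \<omega> = (\<lambda>s. h s + v_lim \<omega> s)" for \<omega>
    by (simp add: fun_eq_iff y_lim_def h_def)
  have y_lim_bdd: "bdd_below (y_lim \<omega> ` I)"
    and y_lim_rc: "\<And>s. s \<in> I \<Longrightarrow> (y_lim \<omega> \<longlongrightarrow> y_lim \<omega> s) (at_right s)" if "\<omega> \<in> space N" for \<omega>
    using cadlag_plus[OF v_lim_cadlag[OF that] h_isCont] unfolding y_lim_eq by blast+
  have y_lim_meas: "(\<lambda>\<omega>. y_lim \<omega> s) \<in> borel_measurable N" for s
  proof -
    have [measurable]: "(\<lambda>\<omega>. v_lim \<omega> s) \<in> borel_measurable N"
      using v_lim_process by (simp add: cadlag_process_def)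
    show ?thesis unfolding y_lim_def by measurable
  qed
  have R_lim_meas: "(\<lambda>\<omega>. R (y_lim \<omega>)) \<in> borel_measurable N"
    unfolding R_def I_def
  proof (rule borel_measurable_right_deriv_gcm[OF _ _ y_lim_meas])
    show "bdd_below (y_lim \<omega> ` {- c..c})" if "\<omega> \<in> space N" for \<omega>
      using y_lim_bdd[OF that] by (simp add: I_def)
    show "(y_lim \<omega> \<longlongrightarrow> y_lim \<omega> s) (at_right s)" if "\<omega> \<in> space N" "- c \<le> s" "s < c" for \<omega> s
      using y_lim_rc[OF that(1), of s] that by (simp add: I_def)
  qed (use c in auto)

  \<comment> \<open>The rescaled processes and measurability of their slopes\<close>
  have inside: "\<forall>\<^sub>F n in sequentially. \<forall>s\<in>I. t\<^sub>0 + s * d n \<in> interior J"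
    unfolding I_def by (rule eventually_rescaled_in_interior[OF t0 d(1,3)])
  have g_isCont: "isCont (g n) s" if "\<forall>s\<in>I. t\<^sub>0 + s * d n \<in> interior J" "s \<in> I" for n s
  proof -
    have "g n = rescaled_drift p (d n) t\<^sub>0 (x\<^sub>b n)" by (rule ext) (rule g_def)
    then show ?thesis using isCont_rescaled_drift[OF x\<^sub>b_convex, of t\<^sub>0 s "d n"] that by simp
  qed
  have y_eq: "y n \<omega> s = g n s + X n \<omega> s"
    if "\<forall>s\<in>I. t\<^sub>0 + s * d n \<in> interior J" "s \<in> I" for n \<omega> s
  proof -
    have "t\<^sub>0 + s * d n \<in> J" using that interior_subset by blast
    then show ?thesis by (simp add: y_def X_def const_extension_eq d(1))
  qed
  \<comment> \<open>The minorant sees only values on \<open>I\<close>, where the constant extension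
    changes nothing; \<open>X n \<omega>\<close> has the advantage of being right continuous with
    left limits on the whole line.\<close>
  have R_eq: "R (y n \<omega>) = R (\<lambda>s. g n s + X n \<omega> s)"
    if "\<forall>s\<in>I. t\<^sub>0 + s * d n \<in> interior J" for n \<omega>
  proof -
    have "gcm I (y n \<omega>) = gcm I (\<lambda>s. g n s + X n \<omega> s)"
      unfolding gcm_def[abs_def] using y_eq[OF that] by (simp cong: conj_cong)
    then show ?thesis by (simp add: R_def)
  qed

  have R_meas: "\<forall>\<^sub>F n in sequentially. (\<lambda>\<omega>. R (y n \<omega>)) \<in> borel_measurable (M n)"
    using inside
  proof eventually_elim
    case (elim n)
    have "(\<lambda>\<omega>. v n \<omega> (t\<^sub>0 + s * d n)) \<in> borel_measurable (M n)" if "s \<in> I" for s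
      using v_process[of n] elim that interior_subset by (auto simp: cadlag_process_def)
    moreover have "(\<lambda>\<omega>. v n \<omega> t\<^sub>0) \<in> borel_measurable (M n)"
      using v_process[of n] t0 interior_subset by (auto simp: cadlag_process_def)
    ultimately have "(\<lambda>\<omega>. y n \<omega> s) \<in> borel_measurable (M n)" if "s \<in> I" for s
      using that unfolding y_def rescaled_noise_def by measurable
    then have meas: "(\<lambda>\<omega>. g n s + X n \<omega> s) \<in> borel_measurable (M n)" if "s \<in> I" for s
      using that unfolding y_eq[OF elim that, symmetric] by blast
    have "(\<lambda>\<omega>. R (\<lambda>s. g n s + X n \<omega> s)) \<in> borel_measurable (M n)"
      unfolding R_def I_def
    proof (rule borel_measurable_right_deriv_gcm[OF _ _ meas])
      fix \<omega> assume \<omega>: "\<omega> \<in> space (M n)"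
      show "bdd_below ((\<lambda>s. g n s + X n \<omega> s) ` {- c..c})"
        using cadlag_plus(1)[OF X_cadlag[OF \<omega>] g_isCont[OF elim]] by (simp add: I_def)
      show "((\<lambda>s. g n s + X n \<omega> s) \<longlongrightarrow> g n s + X n \<omega> s) (at_right s)" if "- c \<le> s" "s < c" for s
        using cadlag_plus(2)[OF X_cadlag[OF \<omega>] g_isCont[OF elim], of s] that by (simp add: I_def)
    qed (use c in \<open>auto simp: I_def\<close>)
    then show ?case by (simp add: R_eq[OF elim])
  qed

  \<comment> \<open>Uniform closeness to the limit on the window\<close>
  have close: "\<exists>r>0. \<forall>\<^sub>F n in sequentially. \<forall>\<omega>'\<in>space (M n).
      mdist D_metric (v_lim \<omega>) (X n \<omega>') < r \<longrightarrow> (\<forall>s\<in>I. \<bar>y n \<omega>' s - y_lim \<omega> s\<bar> \<le> \<delta>)"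
    if \<omega>: "\<omega> \<in> space N" and \<delta>: "0 < \<delta>" for \<omega> \<delta>
  proof -
    \<comment> \<open>Half of \<open>\<delta>\<close> is allotted to the noise and half to the
      distance of the drift from \<open>h\<close>.\<close>
    obtain r where r: "0 < r" "\<And>x z s. x \<in> cadlag_on UNIV \<Longrightarrow> z \<in> cadlag_on UNIV \<Longrightarrow>
        mdist D_metric x z < r \<Longrightarrow> s \<in> I \<Longrightarrow> \<bar>x s - z s\<bar> < \<delta> / 2"
      using D_metric_uniformly_close[of "\<delta> / 2" c] \<delta> unfolding I_def by auto
    have "\<forall>\<^sub>F n in sequentially. (SUP s\<in>I. \<bar>g n s - h s\<bar>) < \<delta> / 2"
      using \<delta> unfolding I_def h_def by (intro order_tendstoD(2)[OF g_conv[OF c]]) simp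
    with inside have "\<forall>\<^sub>F n in sequentially. \<forall>\<omega>'\<in>space (M n).
      mdist D_metric (v_lim \<omega>) (X n \<omega>') < r \<longrightarrow> (\<forall>s\<in>I. \<bar>y n \<omega>' s - y_lim \<omega> s\<bar> \<le> \<delta>)"
    proof eventually_elim
      case (elim n)
      have "continuous_on I (\<lambda>s. \<bar>g n s - h s\<bar>)"
        using g_isCont[OF elim(1)] h_isCont
        by (intro continuous_intros continuous_at_imp_continuous_on) auto
      \<comment> \<open>A real \<open>SUP\<close> bounds its members only when the family is
        bounded, which continuity on the compact window provides.\<close>
      then have bdd: "bdd_above ((\<lambda>s. \<bar>g n s - h s\<bar>) ` I)"
        by (intro bounded_imp_bdd_above compact_imp_bounded compact_continuous_image)
          (simp_all add: I_def)
      have g: "\<bar>g n s - h s\<bar> < \<delta> / 2" if "s \<in> I" for s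
        using cSUP_upper[OF that bdd] elim(2) by linarith
      show ?case
      proof (intro ballI impI)
        fix \<omega>' s
        assume as: "\<omega>' \<in> space (M n)" "mdist D_metric (v_lim \<omega>) (X n \<omega>') < r" "s \<in> I"
        have "y n \<omega>' s - y_lim \<omega> s = (g n s - h s) - (v_lim \<omega> s - X n \<omega>' s)"
          by (simp add: y_eq[OF elim(1) as(3)] y_lim_eq)
        then show "\<bar>y n \<omega>' s - y_lim \<omega> s\<bar> \<le> \<delta>"
          using r(2)[OF v_lim_cadlag[OF \<omega>] X_cadlag[OF as(1)] as(2,3)] g[OF as(3)] by linarith
      qed
    qed
    then show ?thesis using r(1) by blast
  qed

  \<comment> \<open>Absence of kinks simultaneously for all slopes\<close>
  have "AE \<omega> in N. \<forall>a\<in>\<rat>. \<forall>\<epsilon>\<in>\<rat>. 0 < \<epsilon> \<longrightarrow>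
      \<not> (\<forall>s\<in>I. 0 \<le> y_lim \<omega> s - y_lim \<omega> 0 - a * s - \<epsilon> * \<bar>s\<bar>)"
  proof -
    have "AE \<omega> in N. 0 < \<epsilon> \<longrightarrow> \<not> (\<forall>s\<in>I. 0 \<le> y_lim \<omega> s - y_lim \<omega> 0 - a * s - \<epsilon> * \<bar>s\<bar>)" for a \<epsilon>
    proof (cases "0 < \<epsilon>")
      case True
      let ?B = "{\<omega> \<in> space N. \<forall>s\<in>I. 0 \<le> y_lim \<omega> s - y_lim \<omega> 0 - a * s - \<epsilon> * \<bar>s\<bar>}"
      \<comment> \<open>Measurability is checked because \<open>measure\<close> is also zero on sets
        outside the sigma-algebra, so the value zero alone does not give a null set.\<close>
      have "Measurable.pred N (\<lambda>\<omega>. \<forall>s\<in>I. 0 \<le> y_lim \<omega> s - y_lim \<omega> 0 - a * s - \<epsilon> * \<bar>s\<bar>)"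
        unfolding I_def
      proof (rule pred_right_continuous_nonneg)
        show "(\<lambda>\<omega>. y_lim \<omega> s - y_lim \<omega> 0 - a * s - \<epsilon> * \<bar>s\<bar>) \<in> borel_measurable N" for s
          using y_lim_meas by measurable
        show "((\<lambda>s. y_lim \<omega> s - y_lim \<omega> 0 - a * s - \<epsilon> * \<bar>s\<bar>) \<longlongrightarrow>
            y_lim \<omega> s - y_lim \<omega> 0 - a * s - \<epsilon> * \<bar>s\<bar>) (at_right s)"
          if "\<omega> \<in> space N" "- c \<le> s" "s < c" for \<omega> s
          using y_lim_rc[OF that(1), of s] that by (intro tendsto_intros) (simp add: I_def)
      qed
      then have B: "?B \<in> sets N" by (simp add: pred_def)
      have "measure N ?B = 0"
        using y_lim_no_kink[OF c True, of a] by (simp add: I_def algebra_simps)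
      then have "AE \<omega> in N. \<omega> \<notin> ?B" using B by (simp only: N.prob_eq_0)
      then show ?thesis using AE_space by eventually_elim simp
    qed simp
    then show ?thesis by (simp add: AE_ball_countable countable_rat)
  qed
  then have no_kink: "AE \<omega> in N. \<forall>a. \<forall>\<epsilon>>0. \<exists>s\<in>I. y_lim \<omega> s - y_lim \<omega> 0 - a * (s - 0) < \<epsilon> * \<bar>s - 0\<bar>"
  proof eventually_elim
    case (elim \<omega>)
    show ?case
    proof (intro allI impI)
      fix a \<epsilon> :: real assume \<epsilon>: "0 < \<epsilon>"
      \<comment> \<open>The rational slope \<open>q\<close> is off by less than
        \<open>\<epsilon> / 2\<close>, and the rational tolerance \<open>\<eta>\<close> is below
        \<open>\<epsilon> / 2\<close>; together they stay within
        \<open>\<epsilon> * \<bar>s\<bar>\<close>.\<close>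
      obtain q where q: "q \<in> \<rat>" "a < q" "q < a + \<epsilon> / 2"
        using Rats_dense_in_real[of a "a + \<epsilon> / 2"] \<epsilon> by auto
      obtain \<eta> where \<eta>: "\<eta> \<in> \<rat>" "0 < \<eta>" "\<eta> < \<epsilon> / 2"
        using Rats_dense_in_real[of 0 "\<epsilon> / 2"] \<epsilon> by auto
      obtain s where s: "s \<in> I" "y_lim \<omega> s - y_lim \<omega> 0 - q * s < \<eta> * \<bar>s\<bar>"
        using elim q(1) \<eta>(1,2) by force
      have "(q - a) * s \<le> (\<epsilon> - \<eta>) * \<bar>s\<bar>"
      proof -
        have "(q - a) * s \<le> (q - a) * \<bar>s\<bar>" using q by (intro mult_left_mono) auto
        also have "\<dots> \<le> (\<epsilon> - \<eta>) * \<bar>s\<bar>" using q \<eta> by (intro mult_right_mono) auto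
        finally show ?thesis .
      qed
      then have "y_lim \<omega> s - y_lim \<omega> 0 - a * (s - 0) < \<epsilon> * \<bar>s - 0\<bar>"
        using s(2) by (simp add: algebra_simps)
      then show "\<exists>s\<in>I. y_lim \<omega> s - y_lim \<omega> 0 - a * (s - 0) < \<epsilon> * \<bar>s - 0\<bar>" using s(1) by blast
    qed
  qed

  \<comment> \<open>A countable set approximating the limiting noise\<close>
  obtain S where S: "S \<subseteq> mspace D_metric" "separable_space (subtopology (mtopology_of D_metric) S)"
    "AE \<omega> in N. y_lim \<omega> \<in> S"
    using y_lim_regular by blast
  obtain C where C: "countable C" "C \<subseteq> S" "\<And>z e. z \<in> S \<Longrightarrow> 0 < e \<Longrightarrow> \<exists>u\<in>C. mdist D_metric u z < e"
    by (rule separable_subset_countable_dense[OF S(2,1)]) blast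
  \<comment> \<open>Separability is given for \<open>y_lim\<close>, whereas convergence concerns
    \<open>v_lim\<close>; subtracting \<open>h\<close> passes from one to the other.\<close>
  define C' where "C' = (\<lambda>u s. u s - h s) ` C"
  have C': "countable C'" "C' \<subseteq> mspace D_metric"
    using C(1,2) S(1) cadlag_diff_continuous[OF _ h_cont] by (auto simp: C'_def)
  have C'_dense: "AE \<omega> in N. \<forall>e>0. \<exists>u\<in>C'. mdist D_metric u (v_lim \<omega>) < e"
    using S(3) AE_space
  proof eventually_elim
    case (elim \<omega>)
    show ?case
    proof (intro allI impI)
      fix e :: real assume "0 < e"
      then obtain u where u: "u \<in> C" "mdist D_metric u (y_lim \<omega>) < e" using C(3) elim by blast
      have uD: "u \<in> cadlag_on UNIV" "y_lim \<omega> \<in> cadlag_on UNIV" using u(1) C(2) S(1) elim by auto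
      have v: "v_lim \<omega> = (\<lambda>s. y_lim \<omega> s - h s)" by (simp add: y_lim_eq)
      have "mdist D_metric (\<lambda>s. u s - h s) (v_lim \<omega>) = mdist D_metric u (y_lim \<omega>)"
        unfolding v using uD cadlag_diff_continuous[OF _ h_cont]
        by (simp add: mdist_D_metric rho_translate)
      then show "\<exists>u\<in>C'. mdist D_metric u (v_lim \<omega>) < e" using u unfolding C'_def by force
    qed
  qed

  \<comment> \<open>Transfer of probabilities and conclusion\<close>
  have conv: "converges_in_law D_metric (ball_algebra D_metric) M X N v_lim"
    using v_conv unfolding X_def[abs_def] .
  have liminf: "\<forall>\<^sub>F n in sequentially. measure N {\<omega> \<in> space N. P (R (y_lim \<omega>))} - e
      < measure (M n) {\<omega> \<in> space (M n). P (R (y n \<omega>))}"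
    if P: "Measurable.pred borel P" and e: "0 < e"
      and stable: "AE \<omega> in N. P (R (y_lim \<omega>)) \<longrightarrow>
        (\<exists>\<delta>>0. \<forall>w. (\<forall>s\<in>I. \<bar>w s - y_lim \<omega> s\<bar> \<le> \<delta>) \<longrightarrow> P (R w))" for P e
  proof (rule converges_in_law_liminf[OF conv prob _ _ C' C'_dense _ e])
    show "\<forall>\<^sub>F n in sequentially. {\<omega> \<in> space (M n). P (R (y n \<omega>))} \<in> sets (M n)"
      using R_meas
    proof eventually_elim
      case (elim n)
      show ?case using measurable_compose[OF elim P] by (simp add: pred_def)
    qed
    show "{\<omega> \<in> space N. P (R (y_lim \<omega>))} \<in> sets N"
      using measurable_compose[OF R_lim_meas P] by (simp add: pred_def)
    show "AE \<omega> in N. \<omega> \<in> {\<omega> \<in> space N. P (R (y_lim \<omega>))} \<longrightarrow> (\<exists>r>0. \<forall>\<^sub>F n in sequentially.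
        \<forall>\<omega>'\<in>space (M n). mdist D_metric (v_lim \<omega>) (X n \<omega>') < r \<longrightarrow>
          \<omega>' \<in> {\<omega> \<in> space (M n). P (R (y n \<omega>))})"
      using stable AE_space
    proof eventually_elim
      case (elim \<omega>)
      show ?case
      proof
        assume "\<omega> \<in> {\<omega> \<in> space N. P (R (y_lim \<omega>))}"
        then obtain \<delta> where \<delta>: "0 < \<delta>"
            "\<And>w. \<forall>s\<in>I. \<bar>w s - y_lim \<omega> s\<bar> \<le> \<delta> \<Longrightarrow> P (R w)"
          using elim(1) by blast
        obtain r where r: "0 < r" "\<forall>\<^sub>F n in sequentially. \<forall>\<omega>'\<in>space (M n).
            mdist D_metric (v_lim \<omega>) (X n \<omega>') < r \<longrightarrow> (\<forall>s\<in>I. \<bar>y n \<omega>' s - y_lim \<omega> s\<bar> \<le> \<delta>)"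
          using close[OF elim(2) \<delta>(1)] by blast
        from r(2) have "\<forall>\<^sub>F n in sequentially. \<forall>\<omega>'\<in>space (M n).
            mdist D_metric (v_lim \<omega>) (X n \<omega>') < r \<longrightarrow> \<omega>' \<in> {\<omega> \<in> space (M n). P (R (y n \<omega>))}"
          by eventually_elim (use \<delta>(2) in blast)
        then show "\<exists>r>0. \<forall>\<^sub>F n in sequentially. \<forall>\<omega>'\<in>space (M n).
            mdist D_metric (v_lim \<omega>) (X n \<omega>') < r \<longrightarrow> \<omega>' \<in> {\<omega> \<in> space (M n). P (R (y n \<omega>))}"
          using r(1) by blast
      qed
    qed
  qed

  have "AE \<omega> in N. R (y_lim \<omega>) < a \<longrightarrow>
      (\<exists>\<delta>>0. \<forall>w. (\<forall>s\<in>I. \<bar>w s - y_lim \<omega> s\<bar> \<le> \<delta>) \<longrightarrow> R w < a)" for a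
    unfolding R_def using right_deriv_gcm_upper_semicontinuous[OF I y_lim_bdd] by auto
  then have less: "\<forall>\<^sub>F n in sequentially. measure N {\<omega> \<in> space N. R (y_lim \<omega>) < a} - e
      < measure (M n) {\<omega> \<in> space (M n). R (y n \<omega>) < a}" if "0 < e" for a e
    using that by (intro liminf[of "\<lambda>r. r < a"]) auto
  \<comment> \<open>The bound from below is obtained off the null set of paths with a kink at 0, so
    this stability is almost sure.\<close>
  have "AE \<omega> in N. a < R (y_lim \<omega>) \<longrightarrow>
      (\<exists>\<delta>>0. \<forall>w. (\<forall>s\<in>I. \<bar>w s - y_lim \<omega> s\<bar> \<le> \<delta>) \<longrightarrow> a < R w)" for a
    using no_kink AE_space
  proof eventually_elim
    case (elim \<omega>)
    have "0 \<in> I" using c by (simp add: I_def)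
    then show ?case
      unfolding R_def using elim
      by (intro impI right_deriv_gcm_lower_semicontinuous[OF I y_lim_bdd y_lim_rc]) auto
  qed
  then have greater: "\<forall>\<^sub>F n in sequentially. measure N {\<omega> \<in> space N. a < R (y_lim \<omega>)} - e
      < measure (M n) {\<omega> \<in> space (M n). a < R (y n \<omega>)}" if "0 < e" for a e
    using that by (intro liminf[of "\<lambda>r. a < r"]) auto
  have "weak_conv_m (\<lambda>n. distr (M n) borel (\<lambda>\<omega>. R (y n \<omega>))) (distr N borel (\<lambda>\<omega>. R (y_lim \<omega>)))"
    by (rule weak_conv_m_distrI[OF prob R_meas R_lim_meas less greater])
  then show ?thesis
    using R_lim_meas R_meas unfolding R_def I_def by (intro conjI)
qed

end
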